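(* Let $\Omega\subset\mathbb R^d$ be a bounded convex body and let $P(D)=D^2+pD+q$ with constants $p,q\in\mathbb R$. Then $$R_n\big(W^{P(D)}_\infty(\Omega)\big)\le \frac14\left(\frac{\Theta(d)\,\mu_d(\Omega)}{\nu_d\, n}\right)^{2/d}(1+o(1))\qquad (n\to\infty),$$ i.e. $\limsup_{n\to\infty} n^{2/d}R_n\big(W^{P(D)}_\infty(\Omega)\big)\le \frac14\left(\frac{\Theta(d)\mu_d(\Omega)}{\nu_d}\right)^{2/d}$.
   Context: A convex body is a compact convex set with non-empty interior. $\mu_d$ is Lebesgue measure on $\mathbb R^d$, $\nu_d$ the volume of the unit ball of $\mathbb R^d$. Function class: for a convex body $\Omega$ and $P(D)=D^2+pD+q$, $W^{P(D)}_\infty(\Omega)$ is the set of $f:\Omega\to\mathbb R$ such that $f\in C^1(\Omega)$ and, for every unit vector $u\in\mathbb R^d$, the second directional derivative $\partial^2 f/\partial u^2$ exists in the generalized sense (for almost every line parallel to $u$ meeting the interior of $\Omega$, the restriction of $\partial f/\partial u$ to that line is locally absolutely continuous), and $\operatorname{ess\,sup}_{x\in\Omega}\big|\frac{\partial^2 f}{\partial u^2}(x)+p\frac{\partial f}{\partial u}(x)+qf(x)\big|\le1$. Recovery: for a finite set $\xi\subset\Omega$, the information is $I_\xi(f)=\{(f(x),\nabla f(x)):x\in\xi\}$. An algorithm is any map $\phi$ from the information to $C(\Omega)$. $R(W^{P(D)}_\infty(\Omega),\xi)=\inf_\phi\sup_{f\in W^{P(D)}_\infty(\Omega)}\|f-\phi(I_\xi(f))\|_\infty$,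 and $R_n(W^{P(D)}_\infty(\Omega))=\inf\{R(W^{P(D)}_\infty(\Omega),\xi):\xi\subset\Omega,\ \operatorname{card}\xi\le n\}$. Covering density: a covering of $\mathbb R^d$ is a countable family $\mathcal M$ of balls of equal radius whose union is $\mathbb R^d$; $\operatorname{dens}\mathcal M=\liminf_{R\to\infty}\sum_{B\in\mathcal M}\mu_d(B\cap[-R,R]^d)/\mu_d([-R,R]^d)$, and $\Theta(d)=\inf\{\operatorname{dens}\mathcal M:\mathcal M\text{ covers }\mathbb R^d\}$. *)

theory Defs
  imports "HOL-Analysis.Analysis"
begin

definition convex_body :: "'a::euclidean_space set \<Rightarrow> bool" where
  "convex_body \<Omega> \<longleftrightarrow> compact \<Omega> \<and> convex \<Omega> \<and> interior \<Omega> \<noteq> {}"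

definition abs_cont_on :: "real set \<Rightarrow> (real \<Rightarrow> real) \<Rightarrow> bool" where
  "abs_cont_on S g \<longleftrightarrow> (\<forall>\<epsilon>>0. \<exists>\<delta>>0. \<forall>(n::nat) a b.
      (\<forall>i<n. a i \<le> b i \<and> {a i..b i} \<subseteq> S) \<and>
      (\<forall>i<n. \<forall>j<n. i \<noteq> j \<longrightarrow> {a i<..<b i} \<inter> {a j<..<b j} = {}) \<and>
      (\<Sum>i<n. b i - a i) < \<delta> \<longrightarrow> (\<Sum>i<n. \<bar>g (b i) - g (a i)\<bar>) < \<epsilon>)"

definition loc_abs_cont_on :: "real set \<Rightarrow> (real \<Rightarrow> real) \<Rightarrow> bool" where
  "loc_abs_cont_on J g \<longleftrightarrow> (\<forall>a b. {a..b} \<subseteq> J \<longrightarrow> abs_cont_on {a..b} g)"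

text \<open>Gradient of f at x relative to \<Omega> (unique on a convex body).\<close>
definition grad :: "'a::euclidean_space set \<Rightarrow> ('a \<Rightarrow> real) \<Rightarrow> 'a \<Rightarrow> 'a" where
  "grad \<Omega> f x = (SOME v. (f has_derivative (\<lambda>h. v \<bullet> h)) (at x within \<Omega>))"

definition C1_on :: "'a::euclidean_space set \<Rightarrow> ('a \<Rightarrow> real) \<Rightarrow> bool" where
  "C1_on \<Omega> f \<longleftrightarrow> (\<exists>g. continuous_on \<Omega> g \<and>
      (\<forall>x\<in>\<Omega>. (f has_derivative (\<lambda>h. g x \<bullet> h)) (at x within \<Omega>)))"

text \<open>The class W^{P(D)}_infinity(\<Omega>) for P(D) = D^2 + pD + q.  Lines parallel to u
  meeting the interior are parametrised by their points x in the interior.\<close>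
definition W_class :: "real \<Rightarrow> real \<Rightarrow> 'a::euclidean_space set \<Rightarrow> ('a \<Rightarrow> real) set" where
  "W_class p q \<Omega> = {f. C1_on \<Omega> f \<and>
     (\<forall>u::'a. norm u = 1 \<longrightarrow>
        (AE x in lebesgue_on (interior \<Omega>).
           loc_abs_cont_on {t. x + t *\<^sub>R u \<in> interior \<Omega>}
             (\<lambda>t. grad \<Omega> f (x + t *\<^sub>R u) \<bullet> u)) \<and>
        (AE x in lebesgue_on \<Omega>. \<exists>D.
           ((\<lambda>t. grad \<Omega> f (x + t *\<^sub>R u) \<bullet> u) has_real_derivative D) (at 0) \<and>
           \<bar>D + p * (grad \<Omega> f x \<bullet> u) + q * f x\<bar> \<le> 1))}"

definition info :: "'a::euclidean_space set \<Rightarrow> ('a \<Rightarrow> real) \<Rightarrow> 'a set \<Rightarrow> 'a \<Rightarrow> real \<times> 'a" where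
  "info \<Omega> f \<xi> = (\<lambda>x. if x \<in> \<xi> then (f x, grad \<Omega> f x) else (0, 0))"

definition rec_err :: "real \<Rightarrow> real \<Rightarrow> 'a::euclidean_space set \<Rightarrow> 'a set \<Rightarrow> ereal" where
  "rec_err p q \<Omega> \<xi> =
     (INF \<phi>\<in>{\<phi> :: ('a \<Rightarrow> real \<times> 'a) \<Rightarrow> 'a \<Rightarrow> real. \<forall>I. continuous_on \<Omega> (\<phi> I)}.
        SUP f\<in>W_class p q \<Omega>. SUP x\<in>\<Omega>. ereal \<bar>f x - \<phi> (info \<Omega> f \<xi>) x\<bar>)"

definition R_n :: "real \<Rightarrow> real \<Rightarrow> 'a::euclidean_space set \<Rightarrow> nat \<Rightarrow> ereal" where
  "R_n p q \<Omega> n = (INF \<xi>\<in>{\<xi>. \<xi> \<subseteq> \<Omega> \<and> finite \<xi> \<and> card \<xi> \<le> n}. rec_err p q \<Omega> \<xi>)"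

definition covering :: "'a::euclidean_space set \<Rightarrow> real \<Rightarrow> bool" where
  "covering C r \<longleftrightarrow> countable C \<and> r > 0 \<and> (\<Union>c\<in>C. cball c r) = UNIV"

definition cube :: "real \<Rightarrow> 'a::euclidean_space set" where
  "cube R = cbox (- (R *\<^sub>R One)) (R *\<^sub>R One)"

definition cov_dens :: "'a::euclidean_space set \<Rightarrow> real \<Rightarrow> ennreal" where
  "cov_dens C r = Liminf at_top (\<lambda>R::real.
      (\<Sum>\<^sub>\<infinity>c\<in>C. emeasure lborel (cball c r \<inter> cube R)) / emeasure lborel (cube R :: 'a set))"

definition Theta :: "'a::euclidean_space itself \<Rightarrow> ennreal" where
  "Theta _ = (INF Cr\<in>{(C :: 'a set, r). covering C r}. cov_dens (fst Cr) (snd Cr))"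

end

theory Submission
  imports Defs
begin

text \<open>
  If two members of the class carry the same information at the nodes, their difference \<open>h\<close> has
  zero value and gradient there, and along segments \<open>|h'' + p h' + q h| \<le> 2\<close>. At a point where \<open>h\<close>
  attains its maximum in the interior the gradient of \<open>h\<close> vanishes as well, so on the segment of
  length \<open>s \<le> r\<close> to the nearest node the derivative of \<open>h\<close> is zero at both ends, whence
  \<open>h \<le> 2 (1 + O(r)) s\<^sup>2/4\<close>. At a boundary maximum only \<open>h \<le> 2 (1 + O(r)) s\<^sup>2/2\<close> is available, which is
  compensated by placing nodes at distance at most \<open>r/2\<close> from every boundary point. Since the
  boundary is a null set, this costs \<open>o(r\<^sup>-\<^sup>d)\<close> nodes; the remaining ones come from a rescaled periodic
  covering of almost optimal density. The recovery algorithm returns the midpoint of the upper and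
  lower envelopes of all functions consistent with the data; it is continuous because the
  differences of such functions are uniformly Lipschitz.
\<close>

section \<open>Absolutely continuous functions\<close>

text \<open>The constant 1/4 is a product of three factors: 2, because the second-order expressions
  of two members of the class may differ by 2; 1/4, from a derivative that vanishes at both ends of
  a segment; and 1/2, from the midpoint of the envelopes. What remains is r^2, and a covering of
  density close to \<Theta> by balls of radius r spends about \<Theta> \<mu> / (\<nu> r^d) of them
  on \<Omega>, so n nodes turn r^2 into the stated power. The terms with p and q are of lower order
  in r and only affect the factor 1 + o(1). The main obstacle is that the class controls second
  derivatives on almost every line through the interior, whereas the segment from a maximum point to
  its node is one particular segment, possibly inside the boundary. So second derivatives are
  eliminated early, in favour of an inequality between gradients at the endpoints and values along
  the segment, which depends continuously on the endpoints. A second obstacle is that nodes must lie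
  in \<Omega> while balls of a covering may be centred outside; the additional net near the boundary
  repairs this as well.\<close>

lemma abs_cont_onE:
  assumes "abs_cont_on S g" and "e > 0"
  obtains d where "d > 0" and "\<forall>(n::nat) a b. (\<forall>i<n. a i \<le> b i \<and> {a i..b i} \<subseteq> S) \<and>
      (\<forall>i<n. \<forall>j<n. i \<noteq> j \<longrightarrow> {a i<..<b i} \<inter> {a j<..<b j} = {}) \<and>
      (\<Sum>i<n. b i - a i) < d \<longrightarrow> (\<Sum>i<n. \<bar>g (b i) - g (a i)\<bar>) < e"
  using assms(1)[unfolded abs_cont_on_def, THEN spec, THEN mp, OF assms(2)] by (elim exE conjE)

text \<open>Needed because the differential inequality is proved by adding to the absolutely
  continuous derivative a correction that is only known to be Lipschitz. Each summand uses up half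
  of e.\<close>

lemma abs_cont_on_add_lipschitz:
  assumes g: "abs_cont_on S g" and l: "L-lipschitz_on S k"
  shows "abs_cont_on S (\<lambda>t. g t + k t)"
  unfolding abs_cont_on_def
proof (intro allI impI)
  fix e :: real assume "e > 0"
  have L: "L \<ge> 0" using l by (rule lipschitz_on_nonneg)
  from \<open>e > 0\<close> have "e / 2 > 0" by simp
  obtain d where d: "d > 0" and D: "\<forall>(n::nat) a b. (\<forall>i<n. a i \<le> b i \<and> {a i..b i} \<subseteq> S) \<and>
      (\<forall>i<n. \<forall>j<n. i \<noteq> j \<longrightarrow> {a i<..<b i} \<inter> {a j<..<b j} = {}) \<and>
      (\<Sum>i<n. b i - a i) < d \<longrightarrow> (\<Sum>i<n. \<bar>g (b i) - g (a i)\<bar>) < e/2"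
    by (rule abs_cont_onE[OF g \<open>e / 2 > 0\<close>])
  show "\<exists>\<delta>>0. \<forall>(n::nat) a b.
      (\<forall>i<n. a i \<le> b i \<and> {a i..b i} \<subseteq> S) \<and>
      (\<forall>i<n. \<forall>j<n. i \<noteq> j \<longrightarrow> {a i<..<b i} \<inter> {a j<..<b j} = {}) \<and>
      (\<Sum>i<n. b i - a i) < \<delta> \<longrightarrow>
      (\<Sum>i<n. \<bar>g (b i) + k (b i) - (g (a i) + k (a i))\<bar>) < e"
  \<comment> \<open>\<open>L + 1\<close> instead of \<open>L\<close> keeps the quotient meaningful
    for \<open>L = 0\<close>.\<close>
  proof (intro exI[of _ "min d (e / (2 * (L + 1)))"] conjI allI impI)
    show "0 < min d (e / (2 * (L + 1)))" using d L \<open>e > 0\<close> by simp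
    fix n :: nat and a b :: "nat \<Rightarrow> real"
    assume *: "(\<forall>i<n. a i \<le> b i \<and> {a i..b i} \<subseteq> S) \<and>
      (\<forall>i<n. \<forall>j<n. i \<noteq> j \<longrightarrow> {a i<..<b i} \<inter> {a j<..<b j} = {}) \<and>
      (\<Sum>i<n. b i - a i) < min d (e / (2 * (L + 1)))"
    have 1: "(\<Sum>i<n. \<bar>g (b i) - g (a i)\<bar>) < e/2"
      by (rule D[THEN spec, THEN spec, THEN spec, THEN mp]) (use * in simp)
    have 2: "(\<Sum>i<n. \<bar>k (b i) - k (a i)\<bar>) \<le> (\<Sum>i<n. L * (b i - a i))"
    proof (rule sum_mono)
      fix i assume "i \<in> {..<n}"
      then have "a i \<le> b i" "{a i..b i} \<subseteq> S" using * by auto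
      then have "a i \<in> S" "b i \<in> S" by auto
      then show "\<bar>k (b i) - k (a i)\<bar> \<le> L * (b i - a i)"
        using lipschitz_onD[OF l, of "b i" "a i"] \<open>a i \<le> b i\<close> by (simp add: dist_real_def)
    qed
    have 3: "(\<Sum>i<n. L * (b i - a i)) \<le> L * (e / (2 * (L + 1)))"
      unfolding sum_distrib_left[symmetric] using * by (intro mult_left_mono[OF _ L]) linarith
    have 4: "L * (e / (2 * (L + 1))) \<le> e/2"
      using L \<open>e > 0\<close> by (simp add: field_simps)
    have "(\<Sum>i<n. \<bar>g (b i) + k (b i) - (g (a i) + k (a i))\<bar>)
        \<le> (\<Sum>i<n. \<bar>g (b i) - g (a i)\<bar> + \<bar>k (b i) - k (a i)\<bar>)"
      by (intro sum_mono) linarith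
    also have "\<dots> < e" using 1 2 3 4 unfolding sum.distrib by linarith
    finally show "(\<Sum>i<n. \<bar>g (b i) + k (b i) - (g (a i) + k (a i))\<bar>) < e" .
  qed
qed

text \<open>Disjointness is asked of the open intervals only, since neighbouring pieces of a tagged
  division share an endpoint.\<close>

lemma sum_lengths_disjoint_intervals_le:
  fixes a b :: "nat \<Rightarrow> real"
  assumes "\<And>i. i < n \<Longrightarrow> a i \<le> b i" and "\<And>i. i < n \<Longrightarrow> {a i<..<b i} \<subseteq> U"
    and "\<And>i j. i < n \<Longrightarrow> j < n \<Longrightarrow> i \<noteq> j \<Longrightarrow> {a i<..<b i} \<inter> {a j<..<b j} = {}"
    and "U \<in> sets borel"
  shows "ennreal (\<Sum>i<n. b i - a i) \<le> emeasure lborel U"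
proof -
  have "ennreal (\<Sum>i<n. b i - a i) = (\<Sum>i<n. emeasure lborel {a i<..<b i})"
    using assms(1) by (subst sum_ennreal[symmetric]) auto
  also have "\<dots> = emeasure lborel (\<Union>i<n. {a i<..<b i})"
    by (rule sum_emeasure) (use assms(3) in \<open>auto simp: disjoint_family_on_def\<close>)
  also have "\<dots> \<le> emeasure lborel U"
    using assms(2,4) by (intro emeasure_mono) auto
  finally show ?thesis .
qed

text \<open>The straddle lemma: because the tag t lies between u and v, the linearisation errors e
  (t - u) and e (v - t) add up to exactly e (v - u).\<close>

lemma straddle_le:
  assumes "(H has_real_derivative D) (at t within S)" and "D \<le> 0" and "e > (0::real)"
  obtains d where "d > 0"
    "\<And>u v. u \<in> S \<Longrightarrow> v \<in> S \<Longrightarrow> u \<le> t \<Longrightarrow> t \<le> v \<Longrightarrow> t - u < d \<Longrightarrow> v - t < d \<Longrightarrow> H v - H u \<le> e * (v - u)"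
proof -
  have "(H has_derivative (\<lambda>h. D * h)) (at t within S)"
    using assms(1) by (simp add: has_field_derivative_def)
  then obtain d where d: "d > 0"
    "\<And>y. y \<in> S \<Longrightarrow> norm (y - t) < d \<Longrightarrow> norm (H y - H t - D * (y - t)) \<le> e * norm (y - t)"
    using \<open>e > 0\<close> unfolding has_derivative_within_alt by blast
  show ?thesis
  proof
    fix u v assume *: "u \<in> S" "v \<in> S" "u \<le> t" "t \<le> v" "t - u < d" "v - t < d"
    have "\<bar>H u - H t - D * (u - t)\<bar> \<le> e * (t - u)" "\<bar>H v - H t - D * (v - t)\<bar> \<le> e * (v - t)"
      using d(2)[of u] d(2)[of v] * by auto
    moreover have "D * (v - u) \<le> 0" using \<open>D \<le> 0\<close> * by (simp add: mult_nonpos_nonneg)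
    ultimately show "H v - H u \<le> e * (v - u)" by (simp add: algebra_simps abs_le_iff)
  qed (rule d)
qed

text \<open>
  Cousin's lemma: on the intervals tagged outside \<open>N\<close> the increment is controlled by the derivative;
  those tagged in \<open>N\<close> lie in an open set of small measure and are controlled by absolute continuity.
\<close>

lemma abs_cont_on_nonincreasing:
  fixes H :: "real \<Rightarrow> real"
  assumes ac: "abs_cont_on {a..b} H" and ab: "a \<le> b" and N: "N \<in> null_sets lborel"
    and der: "\<And>t. t \<in> {a..b} - N \<Longrightarrow> \<exists>D\<le>0. (H has_real_derivative D) (at t within {a..b})"
  shows "H b \<le> H a"
proof -
  have main: "H b - H a \<le> e * (b - a) + e" if "e > 0" for e
  proof -
    obtain \<delta> where \<delta>: "\<delta> > 0" and AC: "\<forall>(n::nat) a' b'. (\<forall>i<n. a' i \<le> b' i \<and> {a' i..b' i} \<subseteq> {a..b}) \<and>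
      (\<forall>i<n. \<forall>j<n. i \<noteq> j \<longrightarrow> {a' i<..<b' i} \<inter> {a' j<..<b' j} = {}) \<and>
      (\<Sum>i<n. b' i - a' i) < \<delta> \<longrightarrow> (\<Sum>i<n. \<bar>H (b' i) - H (a' i)\<bar>) < e"
      by (rule abs_cont_onE[OF ac \<open>e > 0\<close>])
    obtain U where U: "N \<subseteq> U" "open U" "emeasure lborel U < \<delta>"
    proof -
      have "N \<in> sets borel" using N by auto
      from outer_regular_lborel[OF this] obtain U where "open U" "N \<subseteq> U" "emeasure lborel (U - N) < \<delta>"
        using \<delta> by metis
      moreover have "emeasure lborel (U - N) = emeasure lborel U"
        by (rule emeasure_Diff_null_set) (use N \<open>open U\<close> in auto)
      ultimately show ?thesis using that by auto
    qed
    define Q where "Q t g \<longleftrightarrow> t \<in> g \<and> open g \<and> (t \<in> N \<longrightarrow> g \<subseteq> U) \<and>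
        (\<forall>u v. t \<notin> N \<longrightarrow> u \<in> {a..b} \<longrightarrow> v \<in> {a..b} \<longrightarrow> u \<le> t \<longrightarrow> t \<le> v \<longrightarrow> {u..v} \<subseteq> g \<longrightarrow>
          H v - H u \<le> e * (v - u))" for t g
    have "\<exists>g. Q t g" for t
    proof (cases "t \<in> {a..b} - N")
      case False
      \<comment> \<open>The increment clause of \<open>Q\<close> is vacuous here: either t is in N,
        or t is outside {a..b} and cannot lie between two points u, v of that interval.\<close>
      then have "Q t (if t \<in> N then U else UNIV)"
        unfolding Q_def using U(1,2) by (auto dest: order_trans)
      then show ?thesis by blast
    next
      case True
      from der[OF this] obtain D where D: "D \<le> 0" "(H has_real_derivative D) (at t within {a..b})"
        by blast
      obtain d where d: "d > 0"
        "\<And>u v. u \<in> {a..b} \<Longrightarrow> v \<in> {a..b} \<Longrightarrow> u \<le> t \<Longrightarrow> t \<le> v \<Longrightarrow> t - u < d \<Longrightarrow> v - t < d \<Longrightarrow> H v - H u \<le> e * (v - u)"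
        using straddle_le[OF D(2,1) \<open>e > 0\<close>] by blast
      have "H v - H u \<le> e * (v - u)" if "u \<in> {a..b}" "v \<in> {a..b}" "u \<le> t" "t \<le> v" "{u..v} \<subseteq> ball t d" for u v
      proof (rule d(2))
        have "u \<in> {u..v}" "v \<in> {u..v}" using that by auto
        then have "u \<in> ball t d" "v \<in> ball t d" using that by blast+
        then show "t - u < d" "v - t < d" by (auto simp: dist_real_def)
      qed (use that in auto)
      then have "Q t (ball t d)" unfolding Q_def using True \<open>d > 0\<close> by simp
      then show ?thesis by blast
    qed
    then obtain \<gamma> where "\<And>t. Q t (\<gamma> t)" by metis
    then have \<gamma>: "\<And>t. t \<in> \<gamma> t" "\<And>t. open (\<gamma> t)" "\<And>t. t \<in> N \<Longrightarrow> \<gamma> t \<subseteq> U"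
      "\<And>t u v. t \<notin> N \<Longrightarrow> u \<in> {a..b} \<Longrightarrow> v \<in> {a..b} \<Longrightarrow> u \<le> t \<Longrightarrow> t \<le> v \<Longrightarrow> {u..v} \<subseteq> \<gamma> t \<Longrightarrow> H v - H u \<le> e * (v - u)"
      unfolding Q_def by blast+
    have "gauge \<gamma>" using \<gamma> by (simp add: gauge_def)
    then obtain P where P: "P tagged_division_of {a..b}" "\<gamma> fine P"
      using fine_division_exists_real by metis
    have finP: "finite P" using P(1) by auto
    have k: "\<exists>u v. K = {u..v} \<and> u \<le> t \<and> t \<le> v \<and> u \<in> {a..b} \<and> v \<in> {a..b} \<and> Inf K = u \<and> Sup K = v \<and> K \<subseteq> \<gamma> t \<and> t \<in> {a..b}"
      if tK: "(t, K) \<in> P" for t K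
    proof -
      obtain u v where "K = cbox u v" using tagged_division_ofD(4)[OF P(1) tK] by blast
      moreover have "t \<in> K" "K \<subseteq> {a..b}" using tagged_division_ofD(2,3)[OF P(1) tK] by auto
      moreover have "K \<subseteq> \<gamma> t" using P(2) tK by (auto simp: fine_def)
      ultimately show ?thesis by (intro exI[of _ u] exI[of _ v]) (simp add: subset_iff)
    qed
    define P1 where "P1 = {x \<in> P. fst x \<in> N}"
    define P2 where "P2 = {x \<in> P. fst x \<notin> N}"
    have split: "P = P1 \<union> P2" "P1 \<inter> P2 = {}" "finite P1" "finite P2" "P1 \<subseteq> P" "P2 \<subseteq> P"
      using finP by (auto simp: P1_def P2_def)
    have tele: "(\<Sum>(t,K)\<in>P. h (Sup K) - h (Inf K)) = h b - h a" for h :: "real \<Rightarrow> real"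
      using additive_tagged_division_1[OF ab P(1)] .
    have s2: "(\<Sum>(t,K)\<in>P2. H (Sup K) - H (Inf K)) \<le> e * (b - a)"
    proof -
      have "(\<Sum>(t,K)\<in>P2. H (Sup K) - H (Inf K)) \<le> (\<Sum>(t,K)\<in>P2. e * (Sup K - Inf K))"
      proof (intro sum_mono, clarify)
        fix t K assume "(t, K) \<in> P2"
        then have "(t, K) \<in> P" "t \<notin> N" by (auto simp: P2_def)
        from k[OF this(1)] obtain u v where "K = {u..v}" "u \<le> t" "t \<le> v" "u \<in> {a..b}" "v \<in> {a..b}" "Inf K = u" "Sup K = v" "K \<subseteq> \<gamma> t" "t \<in> {a..b}"
          by blast
        then show "H (Sup K) - H (Inf K) \<le> e * (Sup K - Inf K)"
          using \<gamma>(4)[OF \<open>t \<notin> N\<close>, of u v] by simp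
      qed
      also have "\<dots> \<le> (\<Sum>(t,K)\<in>P. e * (Sup K - Inf K))"
      proof (rule sum_mono2[OF finP split(6)], clarify)
        fix t K assume "(t, K) \<in> P"
        from k[OF this] have "Inf K \<le> Sup K" by force
        then show "0 \<le> e * (Sup K - Inf K)" using \<open>e > 0\<close> by simp
      qed
      also have "\<dots> = e * (b - a)"
        using tele[of "\<lambda>x. e * x"] by (simp add: right_diff_distrib case_prod_unfold)
      finally show ?thesis .
    qed
    have s1: "(\<Sum>(t,K)\<in>P1. H (Sup K) - H (Inf K)) \<le> e"
    proof -
      obtain f where f: "bij_betw f {..<card P1} P1"
        using ex_bij_betw_nat_finite[OF split(3)] by (metis atLeast0LessThan)
      let ?a = "\<lambda>i. Inf (snd (f i))" and ?b = "\<lambda>i. Sup (snd (f i))"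
      have fi: "f i \<in> P" "fst (f i) \<in> N" if "i < card P1" for i
        using bij_betwE[OF f] that by (auto simp: P1_def)
      have ki: "snd (f i) = {?a i..?b i}" "?a i \<le> ?b i" "{?a i..?b i} \<subseteq> {a..b}" "{?a i..?b i} \<subseteq> U" if "i < card P1" for i
      proof -
        have *: "(fst (f i), snd (f i)) \<in> P" using fi[OF that] by simp
        obtain u v where uv: "snd (f i) = {u..v}" "u \<le> fst (f i)" "fst (f i) \<le> v" "u \<in> {a..b}" "v \<in> {a..b}"
          "?a i = u" "?b i = v" "snd (f i) \<subseteq> \<gamma> (fst (f i))"
          using k[OF *] by blast
        show "snd (f i) = {?a i..?b i}" "?a i \<le> ?b i" using uv by simp_all
        show "{?a i..?b i} \<subseteq> {a..b}" unfolding uv(6,7) using uv(4,5) by auto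
        show "{?a i..?b i} \<subseteq> U" unfolding uv(6,7) using uv(1,8) \<gamma>(3)[OF fi(2)[OF that]] by simp
      qed
      have disj: "{?a i<..<?b i} \<inter> {?a j<..<?b j} = {}" if "i < card P1" "j < card P1" "i \<noteq> j" for i j
      proof -
        have "f i \<noteq> f j" using f that by (auto simp: bij_betw_def inj_on_def)
        then have "interior (snd (f i)) \<inter> interior (snd (f j)) = {}"
          using tagged_division_ofD(5)[OF P(1), of "fst (f i)" "snd (f i)" "fst (f j)" "snd (f j)"] fi that
          by (simp add: prod_eq_iff)
        moreover have "interior (snd (f i)) = {?a i<..<?b i}" "interior (snd (f j)) = {?a j<..<?b j}"
          by (subst ki(1)[OF that(1)], rule interior_atLeastAtMost_real, subst ki(1)[OF that(2)], rule interior_atLeastAtMost_real)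
        ultimately show ?thesis by simp
      qed
      have "ennreal (\<Sum>i<card P1. ?b i - ?a i) \<le> emeasure lborel U"
      proof (rule sum_lengths_disjoint_intervals_le)
        show "{?a i<..<?b i} \<subseteq> U" if "i < card P1" for i
          by (rule order_trans[OF _ ki(4)[OF that]]) auto
      qed (use ki(2) disj U(2) in simp_all)
      also have "\<dots> < ennreal \<delta>" by (rule U)
      finally have "(\<Sum>i<card P1. ?b i - ?a i) < \<delta>" 
        using ki(2) by (subst (asm) ennreal_less_iff) (auto intro!: sum_nonneg)
      then have "(\<Sum>i<card P1. \<bar>H (?b i) - H (?a i)\<bar>) < e"
        using ki(2,3) disj by (intro AC[THEN spec, THEN spec, THEN spec, THEN mp]) blast
      moreover have "(\<Sum>(t,K)\<in>P1. H (Sup K) - H (Inf K)) = (\<Sum>i<card P1. H (?b i) - H (?a i))"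
        using sum.reindex_bij_betw[OF f, of "\<lambda>(t,K). H (Sup K) - H (Inf K)"]
        by (simp add: case_prod_unfold)
      moreover have "\<dots> \<le> (\<Sum>i<card P1. \<bar>H (?b i) - H (?a i)\<bar>)" by (intro sum_mono) auto
      ultimately show ?thesis by linarith
    qed
    have "H b - H a = (\<Sum>(t,K)\<in>P1. H (Sup K) - H (Inf K)) + (\<Sum>(t,K)\<in>P2. H (Sup K) - H (Inf K))"
      using tele[of H] sum.union_disjoint[OF split(3,4,2), of "\<lambda>(t,K). H (Sup K) - H (Inf K)"] split(1) by simp
    then show ?thesis using s1 s2 by linarith
  qed
  have "H b - H a \<le> 0"
  proof (rule field_le_epsilon)
    fix e :: real assume "e > 0"
    \<comment> \<open>With this value in place of e the two error terms of \<open>main\<close> add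
      up to e, also when a = b.\<close>
    have "e / (b - a + 1) * (b - a) + e / (b - a + 1) = e / (b - a + 1) * (b - a + 1)"
      by (simp only: distrib_left mult_1_right)
    also have "\<dots> = e" using ab by simp
    finally have "e / (b - a + 1) * (b - a) + e / (b - a + 1) = e" .
    then show "H b - H a \<le> 0 + e" using main[of "e / (b - a + 1)"] ab \<open>e > 0\<close> by simp
  qed
  then show ?thesis by simp
qed

text \<open>\<open>K\<close> is a primitive of p G + q \<phi>, so s G + s K - t has derivative at
  most 0 almost everywhere for s = 1 and s = -1; monotonicity for the two signs gives the two sides
  of the bound. In this way G' is never integrated.\<close>

lemma abs_cont_on_differential_inequality:
  fixes G \<phi> :: "real \<Rightarrow> real"
  assumes ac: "abs_cont_on {a..b} G" and ab: "a \<le> b" and N: "N \<in> null_sets lborel"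
    and \<phi>: "\<And>t. t \<in> {a..b} \<Longrightarrow> (\<phi> has_real_derivative G t) (at t within {a..b})"
    and G: "continuous_on {a..b} G"
    and der: "\<And>t. t \<in> {a..b} - N \<Longrightarrow> \<exists>D. (G has_real_derivative D) (at t) \<and> \<bar>D + p * G t + q * \<phi> t\<bar> \<le> 1"
  shows "\<bar>G b - G a + p * (\<phi> b - \<phi> a) + q * integral {a..b} \<phi>\<bar> \<le> b - a"
proof -
  have c\<phi>: "continuous_on {a..b} \<phi>" using \<phi> by (meson DERIV_continuous_on)
  define I where "I t = integral {a..t} \<phi>" for t
  have I: "(I has_real_derivative \<phi> t) (at t within {a..b})" if "t \<in> {a..b}" for t
    unfolding I_def using integral_has_real_derivative[OF c\<phi> that] .
  define K where "K t = p * \<phi> t + q * I t" for t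
  have K: "(K has_real_derivative p * G t + q * \<phi> t) (at t within {a..b})" if "t \<in> {a..b}" for t
    unfolding K_def using \<phi>[OF that] I[OF that] by (auto intro!: derivative_eq_intros)
  have one_side: "s * (G b - G a + K b - K a) \<le> b - a" if s: "s = 1 \<or> s = -1" for s
  proof -
    have ac': "abs_cont_on {a..b} (\<lambda>t. s * G t)"
    proof -
      have eq: "\<bar>s * G x - s * G y\<bar> = \<bar>G x - G y\<bar>" for x y using s by auto
      show ?thesis using ac unfolding abs_cont_on_def eq .
    qed
    have cont: "continuous_on {a..b} (\<lambda>t. p * G t + q * \<phi> t)"
      by (intro continuous_intros G c\<phi>)
    have "bounded ((\<lambda>t. p * G t + q * \<phi> t) ` {a..b})"
      by (intro compact_imp_bounded compact_continuous_image[OF cont]) simp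
    then obtain B where B: "\<And>t. t \<in> {a..b} \<Longrightarrow> \<bar>p * G t + q * \<phi> t\<bar> \<le> B"
      unfolding bounded_iff by (metis imageI real_norm_def)
    have B0: "0 \<le> B" using B[of a] ab by auto
    have lip: "(B + 1)-lipschitz_on {a..b} (\<lambda>t. s * K t - t)"
    proof (rule bounded_derivative_imp_lipschitz)
      fix t assume t: "t \<in> {a..b}"
      show "((\<lambda>t. s * K t - t) has_derivative (\<lambda>h. (s * (p * G t + q * \<phi> t) - 1) * h)) (at t within {a..b})"
        using K[OF t] unfolding has_field_derivative_def[symmetric]
        by (auto intro!: derivative_eq_intros)
      have "\<bar>s * (p * G t + q * \<phi> t) - 1\<bar> \<le> B + 1" using B[OF t] s by auto
      then show "onorm (\<lambda>h. (s * (p * G t + q * \<phi> t) - 1) * h) \<le> B + 1"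
        by (intro onorm_le) (simp add: abs_mult mult_right_mono)
    qed (use B0 in auto)
    have "(\<lambda>t. s * G t + (s * K t - t)) b \<le> (\<lambda>t. s * G t + (s * K t - t)) a"
    proof (rule abs_cont_on_nonincreasing[OF _ ab N])
      show "abs_cont_on {a..b} (\<lambda>t. s * G t + (s * K t - t))"
        by (rule abs_cont_on_add_lipschitz[OF ac' lip])
      fix t assume t: "t \<in> {a..b} - N"
      from der[OF t] obtain D where D: "(G has_real_derivative D) (at t)" "\<bar>D + p * G t + q * \<phi> t\<bar> \<le> 1"
        by blast
      have "((\<lambda>t. s * G t + (s * K t - t)) has_real_derivative s * D + (s * (p * G t + q * \<phi> t) - 1)) (at t within {a..b})"
        using K[of t] has_field_derivative_at_within[OF D(1)] t by (auto intro!: derivative_eq_intros)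
      moreover have "s * D + (s * (p * G t + q * \<phi> t) - 1) \<le> 0"
        using D(2) s by auto
      ultimately show "\<exists>D\<le>0. ((\<lambda>t. s * G t + (s * K t - t)) has_real_derivative D) (at t within {a..b})"
        by blast
    qed
    then show ?thesis by (simp add: algebra_simps)
  qed
  have "G b - G a + K b - K a = G b - G a + p * (\<phi> b - \<phi> a) + q * integral {a..b} \<phi>"
    by (simp add: K_def I_def algebra_simps)
  then show ?thesis using one_side[of 1] one_side[of "-1"] by (simp add: abs_le_iff)
qed

section \<open>The differential inequality on arbitrary segments\<close>

lemma convex_segment_mem:
  fixes x y :: "'a::real_vector"
  assumes "convex S" "x \<in> S" "y \<in> S" "0 \<le> t" "t \<le> 1"
  shows "x + t *\<^sub>R (y - x) \<in> S"
proof -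
  have "(1 - t) *\<^sub>R x + t *\<^sub>R y \<in> S" using assms by (auto simp: convex_alt)
  then show ?thesis by (simp add: algebra_simps)
qed

lemma has_real_derivative_along_segment:
  fixes h :: "'a::real_inner \<Rightarrow> real"
  assumes d: "\<And>x. x \<in> \<Omega> \<Longrightarrow> (h has_derivative (\<lambda>v. g x \<bullet> v)) (at x within \<Omega>)"
    and seg: "\<And>t. t \<in> {a..b} \<Longrightarrow> x + t *\<^sub>R v \<in> \<Omega>" and t: "t \<in> {a..b}"
  shows "((\<lambda>t. h (x + t *\<^sub>R v)) has_real_derivative g (x + t *\<^sub>R v) \<bullet> v) (at t within {a..b})"
proof -
  have "(h has_derivative (\<lambda>w. g (x + t *\<^sub>R v) \<bullet> w)) (at (x + t *\<^sub>R v) within (\<lambda>t. x + t *\<^sub>R v) ` {a..b})"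
    by (rule has_derivative_subset[OF d]) (use seg t in auto)
  moreover have "((\<lambda>t. x + t *\<^sub>R v) has_derivative (\<lambda>t. t *\<^sub>R v)) (at t within {a..b})"
    by (auto intro!: derivative_eq_intros)
  ultimately have "((\<lambda>t. h (x + t *\<^sub>R v)) has_derivative (\<lambda>s. g (x + t *\<^sub>R v) \<bullet> (s *\<^sub>R v))) (at t within {a..b})"
    by (rule has_derivative_in_compose[rotated])
  then show ?thesis by (simp add: has_field_derivative_def mult_commute_abs)
qed

text \<open>Differentiating along segments of S shows that v - w is orthogonal to z - x for every z
  in S. Two points of a ball inside S that differ by a multiple of v - w then force v = w, even when
  x is a boundary point. This identifies the choice made by \<open>grad\<close> with the continuous
  field of \<open>C1_on\<close>.\<close>

lemma inner_derivative_unique_within_convex: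
  fixes f :: "'a::euclidean_space \<Rightarrow> real"
  assumes S: "convex S" "interior S \<noteq> {}" and x: "x \<in> S"
    and v: "(f has_derivative (\<lambda>h. v \<bullet> h)) (at x within S)"
    and w: "(f has_derivative (\<lambda>h. w \<bullet> h)) (at x within S)"
  shows "v = w"
proof -
  have seg: "x + t *\<^sub>R (z - x) \<in> S" if "z \<in> S" "t \<in> {0..1}" for z t
    using convex_segment_mem[OF S(1) x that(1)] that(2) by auto
  have line: "((\<lambda>t. f (x + t *\<^sub>R (z - x))) has_vector_derivative v \<bullet> (z - x)) (at 0 within {0..1})"
    if z: "z \<in> S" and v: "(f has_derivative (\<lambda>h. v \<bullet> h)) (at x within S)" for z v
  proof -
    have "(f has_derivative (\<lambda>h. v \<bullet> h)) (at (x + 0 *\<^sub>R (z - x)) within (\<lambda>t. x + t *\<^sub>R (z - x)) ` {0..1})"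
      using has_derivative_subset[OF v] seg[OF z] by (simp add: image_subset_iff)
    moreover have "((\<lambda>t. x + t *\<^sub>R (z - x)) has_derivative (\<lambda>t. t *\<^sub>R (z - x))) (at 0 within {0..1})"
      by (auto intro!: derivative_eq_intros)
    ultimately have "((\<lambda>t. f (x + t *\<^sub>R (z - x))) has_derivative (\<lambda>t. v \<bullet> (t *\<^sub>R (z - x)))) (at 0 within {0..1})"
      by (rule has_derivative_in_compose[rotated])
    then show ?thesis by (simp add: has_vector_derivative_def)
  qed
  have eq: "(v - w) \<bullet> (z - x) = 0" if "z \<in> S" for z
  proof -
    have "at (0::real) within {0..1} \<noteq> bot"
      using trivial_limit_at_right_real[of "0::real"] by (simp add: at_within_Icc_at_right)
    from vector_derivative_unique_within[OF this line[OF that v] line[OF that w]]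
    show ?thesis by (simp add: inner_diff_left)
  qed
  obtain c e where e: "e > 0" "ball c e \<subseteq> S" using S(2) mem_interior by blast
  show ?thesis
  proof (rule ccontr)
    assume "v \<noteq> w"
    define k where "k = v - w"
    have k: "norm k > 0" using \<open>v \<noteq> w\<close> by (simp add: k_def)
    let ?z = "c + (e / (2 * norm k)) *\<^sub>R k"
    have "?z \<in> S" "c \<in> S" using e k by (auto intro!: subsetD[OF e(2)] simp: dist_norm)
    then have "k \<bullet> (?z - x) - k \<bullet> (c - x) = 0" using eq unfolding k_def by simp
    then have "(e / (2 * norm k)) * (k \<bullet> k) = 0" by (simp add: inner_diff_right inner_add_right)
    then show False using e k by auto
  qed
qed

lemma C1_on_grad:
  assumes \<Omega>: "convex_body \<Omega>" and f: "C1_on \<Omega> f"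
  shows "continuous_on \<Omega> (grad \<Omega> f)"
    and "x \<in> \<Omega> \<Longrightarrow> (f has_derivative (\<lambda>h. grad \<Omega> f x \<bullet> h)) (at x within \<Omega>)"
    and "continuous_on \<Omega> f"
proof -
  obtain g where g: "continuous_on \<Omega> g" "\<And>x. x \<in> \<Omega> \<Longrightarrow> (f has_derivative (\<lambda>h. g x \<bullet> h)) (at x within \<Omega>)"
    using f unfolding C1_on_def by blast
  have eq: "grad \<Omega> f x = g x" if "x \<in> \<Omega>" for x
  proof -
    have "(f has_derivative (\<lambda>h. grad \<Omega> f x \<bullet> h)) (at x within \<Omega>)"
      unfolding grad_def by (rule someI) (rule g(2)[OF that])
    then show ?thesis
      using inner_derivative_unique_within_convex[of \<Omega> x f] g(2)[OF that] that \<Omega>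
      unfolding convex_body_def by blast
  qed
  show "continuous_on \<Omega> (grad \<Omega> f)" using g(1) eq by (simp cong: continuous_on_cong)
  show "x \<in> \<Omega> \<Longrightarrow> (f has_derivative (\<lambda>h. grad \<Omega> f x \<bullet> h)) (at x within \<Omega>)"
    using g(2) eq by simp
  show "continuous_on \<Omega> f" using g(2) by (rule has_derivative_continuous_on)
qed

section \<open>From almost every line to every segment\<close>

text \<open>Fubini for the map (x, t) to x + t u: for fixed t the exceptional x form a translate of
  N, hence a null set, and the two "almost every" may be exchanged. Lines are indexed by all of
  their points, as in \<open>W_class\<close>, so no transversal hyperplane is needed.\<close>

lemma AE_line_null_set:
  fixes u :: "'a::euclidean_space"
  assumes N: "N \<in> null_sets lborel"
  shows "AE x in lborel. {t::real. x + t *\<^sub>R u \<in> N} \<in> null_sets lborel"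
proof -
  have NB[measurable]: "N \<in> sets borel" using N by auto
  have "AE t in (lborel::real measure). AE x in lborel. x + t *\<^sub>R u \<notin> N"
  proof (rule AE_I2)
    fix t :: real
    have "AE y in lborel. y \<notin> N" using N by (rule AE_not_in)
    moreover have "distr lborel borel ((+) (t *\<^sub>R u)) = lborel" by (rule lborel_distr_plus)
    ultimately have "AE y in distr lborel borel ((+) (t *\<^sub>R u)). y \<notin> N" by metis
    then have "AE x in lborel. t *\<^sub>R u + x \<notin> N"
      by (subst (asm) AE_distr_iff) auto
    then show "AE x in lborel. x + t *\<^sub>R u \<notin> N" by (simp add: add.commute)
  qed
  moreover have meas: "{z \<in> space (lborel \<Otimes>\<^sub>M (lborel :: real measure)). fst z + snd z *\<^sub>R u \<notin> N}
      \<in> sets (lborel \<Otimes>\<^sub>M lborel)"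
    by measurable
  ultimately have "AE x in lborel. AE t in (lborel::real measure). x + t *\<^sub>R u \<notin> N"
    by (subst lborel_pair.AE_commute) assumption+
  then show ?thesis
  proof eventually_elim
    case (elim x)
    have "{t. x + t *\<^sub>R u \<in> N} \<in> sets borel" by measurable
    with elim show ?case by (subst AE_iff_null_sets) auto
  qed
qed

lemma AE_lborel_in_ball:
  fixes x :: "'a::euclidean_space"
  assumes "AE z in lborel. P z" and "e > 0"
  shows "\<exists>z\<in>ball x e. P z"
proof (rule ccontr)
  assume "\<not> ?thesis"
  then have "AE z in lborel. z \<notin> ball x e" using assms(1) by (auto elim: eventually_mono)
  then have "ball x e \<in> null_sets lborel" by (subst AE_iff_null_sets) auto
  then have "negligible (ball x e)" by (simp add: negligible_iff_null_sets null_sets_completionI)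
  then show False using assms(2) open_not_negligible[of "ball x e"] by simp
qed

text \<open>
  The integral of \<open>f'' + p f' + q f\<close> over the segment from \<open>x\<close> to \<open>y\<close>, times its length. In this form the
  inequality passes from almost every line to every segment, including those in the boundary.
\<close>

definition seg_gap :: "real \<Rightarrow> real \<Rightarrow> ('a::euclidean_space \<Rightarrow> 'a) \<Rightarrow> ('a \<Rightarrow> real) \<Rightarrow> 'a \<Rightarrow> 'a \<Rightarrow> real" where
  "seg_gap p q g f x y = (g y - g x) \<bullet> (y - x) + p * norm (y - x) * (f y - f x)
     + q * (norm (y - x))\<^sup>2 * integral {0..1} (\<lambda>s. f (x + s *\<^sub>R (y - x)))"

lemma continuous_on_seg_gap:
  assumes "convex \<Omega>" and g: "continuous_on \<Omega> g" and f: "continuous_on \<Omega> f"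
  shows "continuous_on (\<Omega> \<times> \<Omega>) (\<lambda>z. seg_gap p q g f (fst z) (snd z))"
proof -
  have "continuous_on (\<Omega> \<times> \<Omega>) (\<lambda>z. integral (cbox 0 1) (\<lambda>s::real. f (fst z + s *\<^sub>R (snd z - fst z))))"
  proof (rule integral_continuous_on_param)
    show "continuous_on ((\<Omega> \<times> \<Omega>) \<times> cbox 0 1) (\<lambda>(z, s::real). f (fst z + s *\<^sub>R (snd z - fst z)))"
      unfolding case_prod_unfold
      by (rule continuous_on_compose2[OF f]) (auto intro!: continuous_intros convex_segment_mem[OF assms(1)])
  qed
  then show ?thesis
    unfolding seg_gap_def
    by (auto intro!: continuous_intros continuous_on_compose2[OF g] continuous_on_compose2[OF f])
qed

text \<open>A starting point is good if the gradient component is locally absolutely continuous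
  along its line and the line meets the exceptional points in a null set of parameters. Neither
  condition mentions the length T, hence the quantifier inside \<open>AE\<close>.\<close>

lemma W_class_seg_gap_line:
  fixes \<Omega> :: "'a::euclidean_space set"
  assumes \<Omega>: "convex_body \<Omega>" and f: "f \<in> W_class p q \<Omega>" and u: "norm u = 1"
  shows "AE x in lborel. \<forall>T\<ge>0. x \<in> interior \<Omega> \<longrightarrow> x + T *\<^sub>R u \<in> interior \<Omega> \<longrightarrow>
    \<bar>seg_gap p q (grad \<Omega> f) f x (x + T *\<^sub>R u)\<bar> \<le> T\<^sup>2"
proof -
  let ?g = "grad \<Omega> f"
  have C1: "C1_on \<Omega> f" using f by (simp add: W_class_def)
  note grad = C1_on_grad[OF \<Omega> C1]
  have cvx: "convex (interior \<Omega>)" "compact \<Omega>" using \<Omega> by (auto simp: convex_body_def)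
  have \<Omega>s: "\<Omega> \<in> sets lebesgue" using cvx(2) by (simp add: lmeasurable_compact fmeasurableD)
  let ?L = "\<lambda>x. loc_abs_cont_on {t. x + t *\<^sub>R u \<in> interior \<Omega>} (\<lambda>t. ?g (x + t *\<^sub>R u) \<bullet> u)"
  let ?D = "\<lambda>x. \<exists>D. ((\<lambda>t. ?g (x + t *\<^sub>R u) \<bullet> u) has_real_derivative D) (at 0) \<and>
           \<bar>D + p * (?g x \<bullet> u) + q * f x\<bar> \<le> 1"
  have "AE x in lebesgue_on (interior \<Omega>). ?L x" using f u by (simp add: W_class_def)
  then have A1: "AE x in lborel. x \<in> interior \<Omega> \<longrightarrow> ?L x"
    by (subst (asm) AE_restrict_space_iff) (auto simp: AE_completion_iff)
  have "AE x in lebesgue_on \<Omega>. ?D x" using f u by (simp add: W_class_def)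
  then have "AE x in lborel. x \<in> \<Omega> \<longrightarrow> ?D x"
    using \<Omega>s by (subst (asm) AE_restrict_space_iff) (auto simp: AE_completion_iff)
  \<comment> \<open>\<open>N\<close> contains the points where the pointwise inequality fails;
    almost every line in direction u meets it in a null set of parameters.\<close>
  then obtain N where N: "N \<in> null_sets lborel" "{x \<in> space lborel. \<not> (x \<in> \<Omega> \<longrightarrow> ?D x)} \<subseteq> N"
    by (auto elim!: AE_E simp: null_sets_def)
  from A1 AE_line_null_set[OF N(1), of u] show ?thesis
  proof eventually_elim
    case (elim x)
    show ?case
    proof (intro allI impI)
      fix T :: real assume T: "0 \<le> T" and x: "x \<in> interior \<Omega>" and xT: "x + T *\<^sub>R u \<in> interior \<Omega>"
      have seg: "x + t *\<^sub>R u \<in> interior \<Omega>" if "t \<in> {0..T}" for t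
      proof (cases "T = 0")
        case False
        then show ?thesis using convex_segment_mem[OF cvx(1) x xT, of "t / T"] that T by simp
      qed (use that x in auto)
      have seg': "x + t *\<^sub>R u \<in> \<Omega>" if "t \<in> {0..T}" for t
        using seg[OF that] interior_subset by blast
      let ?G = "\<lambda>t. ?g (x + t *\<^sub>R u) \<bullet> u" and ?\<phi> = "\<lambda>t. f (x + t *\<^sub>R u)"
      have main: "\<bar>?G T - ?G 0 + p * (?\<phi> T - ?\<phi> 0) + q * integral {0..T} ?\<phi>\<bar> \<le> T - 0"
      proof (rule abs_cont_on_differential_inequality[OF _ T elim(2)])
        show "abs_cont_on {0..T} ?G"
          by (rule elim(1)[THEN mp, OF x, unfolded loc_abs_cont_on_def, THEN spec, THEN spec, THEN mp])
            (use seg in auto)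
        show "continuous_on {0..T} ?G"
          by (intro continuous_intros continuous_on_compose2[OF grad(1)]) (use seg' in auto)
        fix t assume t: "t \<in> {0..T}"
        show "(?\<phi> has_real_derivative ?G t) (at t within {0..T})"
          by (rule has_real_derivative_along_segment[OF grad(2) seg' t])
      next
        fix t assume t: "t \<in> {0..T} - {t. x + t *\<^sub>R u \<in> N}"
        then have "x + t *\<^sub>R u \<in> \<Omega>" "x + t *\<^sub>R u \<notin> N" using seg' by auto
        then have "?D (x + t *\<^sub>R u)" using N(2) by auto
        then obtain D where D: "((\<lambda>s. ?g (x + t *\<^sub>R u + s *\<^sub>R u) \<bullet> u) has_real_derivative D) (at 0)"
           "\<bar>D + p * ?G t + q * ?\<phi> t\<bar> \<le> 1" by blast
        have "((\<lambda>s. ?G (s + t)) has_real_derivative D) (at 0)"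
          using D(1) by (simp add: algebra_simps)
        then have "(?G has_real_derivative D) (at t)" using DERIV_shift[of ?G D 0 t] by simp
        then show "\<exists>D. (?G has_real_derivative D) (at t) \<and> \<bar>D + p * ?G t + q * ?\<phi> t\<bar> \<le> 1"
          using D(2) by blast
      qed
      have int: "integral {0..T} ?\<phi> = T * integral {0..1} (\<lambda>s. f (x + s *\<^sub>R (T *\<^sub>R u)))"
      proof (cases "T = 0")
        case False
        have "(\<lambda>x. x / T) ` {0..T} = {0..1}" using T False by (simp add: image_divide_atLeastAtMost)
        then show ?thesis using integral_stretch_real[of T 0 T ?\<phi>] T False
          by (simp add: mult.commute field_simps)
      qed simp
      have "seg_gap p q ?g f x (x + T *\<^sub>R u) = T * (?G T - ?G 0 + p * (?\<phi> T - ?\<phi> 0) + q * integral {0..T} ?\<phi>)"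
        using T u unfolding seg_gap_def int
        by (simp add: algebra_simps power2_eq_square inner_diff_left inner_diff_right)
      then show "\<bar>seg_gap p q ?g f x (x + T *\<^sub>R u)\<bar> \<le> T\<^sup>2"
        using main T by (simp add: abs_mult power2_eq_square mult_left_mono)
    qed
  qed
qed

text \<open>Both sides are continuous in the pair of endpoints, so two approximations suffice. A
  segment with interior endpoints is a limit of translates of itself that start at good points,
  which are dense because they have full measure. An arbitrary segment is a limit of its
  contractions towards an interior point \<open>c\<close>, whose endpoints are interior.\<close>

lemma W_class_seg_gap:
  fixes \<Omega> :: "'a::euclidean_space set"
  assumes \<Omega>: "convex_body \<Omega>" and f: "f \<in> W_class p q \<Omega>" and xy: "x \<in> \<Omega>" "y \<in> \<Omega>"
  shows "\<bar>seg_gap p q (grad \<Omega> f) f x y\<bar> \<le> (norm (y - x))\<^sup>2"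
proof -
  let ?S = "\<lambda>x y. seg_gap p q (grad \<Omega> f) f x y"
  have C1: "C1_on \<Omega> f" using f by (simp add: W_class_def)
  have cvx: "convex \<Omega>" "interior \<Omega> \<noteq> {}" using \<Omega> by (auto simp: convex_body_def)
  have cont: "continuous_on (\<Omega> \<times> \<Omega>) (\<lambda>z. ?S (fst z) (snd z))"
    by (rule continuous_on_seg_gap[OF cvx(1) C1_on_grad(1,3)[OF \<Omega> C1]])
  have lim: "\<bar>?S x y\<bar> \<le> (norm (y - x))\<^sup>2"
    if "x \<in> \<Omega>" "y \<in> \<Omega>" "a \<longlonglongrightarrow> x" "b \<longlonglongrightarrow> y"
      and ev: "\<forall>\<^sub>F k in sequentially. a k \<in> \<Omega> \<and> b k \<in> \<Omega> \<and> \<bar>?S (a k) (b k)\<bar> \<le> (norm (b k - a k))\<^sup>2"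
    for x y and a b :: "nat \<Rightarrow> 'a"
  proof (rule tendsto_le[OF sequentially_bot])
    have "(\<lambda>k. ?S (fst (a k, b k)) (snd (a k, b k))) \<longlonglongrightarrow> ?S (fst (x, y)) (snd (x, y))"
      by (rule continuous_on_tendsto_compose[OF cont])
        (use that in \<open>auto intro!: tendsto_intros elim: eventually_mono\<close>)
    then show "(\<lambda>k. \<bar>?S (a k) (b k)\<bar>) \<longlonglongrightarrow> \<bar>?S x y\<bar>" by (auto intro: tendsto_intros)
    show "(\<lambda>k. (norm (b k - a k))\<^sup>2) \<longlonglongrightarrow> (norm (y - x))\<^sup>2" using that by (auto intro!: tendsto_intros)
    show "\<forall>\<^sub>F k in sequentially. \<bar>?S (a k) (b k)\<bar> \<le> (norm (b k - a k))\<^sup>2"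
      using ev by eventually_elim auto
  qed
  have inner: "\<bar>?S x y\<bar> \<le> (norm (y - x))\<^sup>2" if x: "x \<in> interior \<Omega>" and y: "y \<in> interior \<Omega>" for x y
  proof (cases "x = y")
    case True
    then show ?thesis by (simp add: seg_gap_def)
  next
    case False
    define T where "T = norm (y - x)"
    define u where "u = (y - x) /\<^sub>R T"
    have T: "T > 0" using False by (simp add: T_def)
    have u: "norm u = 1" "T *\<^sub>R u = y - x" using T by (auto simp: u_def T_def)
    let ?P = "\<lambda>z. \<forall>T\<ge>0. z \<in> interior \<Omega> \<longrightarrow> z + T *\<^sub>R u \<in> interior \<Omega> \<longrightarrow> \<bar>?S z (z + T *\<^sub>R u)\<bar> \<le> T\<^sup>2"
    have "\<exists>z\<in>ball x (1 / Suc k). ?P z" for k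
      by (rule AE_lborel_in_ball[OF W_class_seg_gap_line[OF \<Omega> f u(1)]]) simp
    then obtain a where a: "\<And>k. a k \<in> ball x (1 / Suc k)" "\<And>k. ?P (a k)" by metis
    have "a \<longlonglongrightarrow> x"
    proof (rule tendsto_dist_iff[THEN iffD2], rule tendsto_sandwich[where f = "\<lambda>_. 0" and h = "\<lambda>k. 1 / real (Suc k)"])
      show "(\<lambda>k. 1 / real (Suc k)) \<longlonglongrightarrow> 0" by (rule LIMSEQ_Suc[OF lim_1_over_n])
      show "\<forall>\<^sub>F k in sequentially. dist (a k) x \<le> 1 / real (Suc k)"
        using a(1) by (intro always_eventually allI) (simp add: dist_commute less_imp_le)
    qed auto
    have "(\<lambda>k. a k + T *\<^sub>R u) \<longlonglongrightarrow> y"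
      using tendsto_add[OF \<open>a \<longlonglongrightarrow> x\<close> tendsto_const[of "T *\<^sub>R u"]] u by simp
    show ?thesis
    proof (rule lim)
      have "\<forall>\<^sub>F k in sequentially. a k \<in> interior \<Omega>" "\<forall>\<^sub>F k in sequentially. a k + T *\<^sub>R u \<in> interior \<Omega>"
        using topological_tendstoD[OF \<open>a \<longlonglongrightarrow> x\<close> open_interior x]
          topological_tendstoD[OF \<open>(\<lambda>k. a k + T *\<^sub>R u) \<longlonglongrightarrow> y\<close> open_interior y] by auto
      then show "\<forall>\<^sub>F k in sequentially. a k \<in> \<Omega> \<and> a k + T *\<^sub>R u \<in> \<Omega> \<and> \<bar>?S (a k) (a k + T *\<^sub>R u)\<bar> \<le> (norm (a k + T *\<^sub>R u - a k))\<^sup>2"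
      proof eventually_elim
        case (elim k)
        then show ?case using a(2)[of k] T u(1) interior_subset[of \<Omega>] by auto
      qed
    qed (use x y interior_subset \<open>a \<longlonglongrightarrow> x\<close> \<open>(\<lambda>k. a k + T *\<^sub>R u) \<longlonglongrightarrow> y\<close> in auto)
  qed
  obtain c where c: "c \<in> interior \<Omega>" using cvx(2) by blast
  have conv: "(\<lambda>k. z - (1 / real (Suc k)) *\<^sub>R (z - c)) \<longlonglongrightarrow> z" for z
  proof -
    have "(\<lambda>k. z - (1 / real (Suc k)) *\<^sub>R (z - c)) \<longlonglongrightarrow> z - 0 *\<^sub>R (z - c)"
      by (intro tendsto_intros LIMSEQ_Suc[OF lim_1_over_n])
    then show ?thesis by simp
  qed
  have mem: "z - (1 / real (Suc k)) *\<^sub>R (z - c) \<in> interior \<Omega>" if "z \<in> \<Omega>" for z k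
    by (rule mem_interior_closure_convex_shrink[OF cvx(1) c]) (use that closure_subset in auto)
  show ?thesis
  proof (rule lim[OF xy conv conv])
    show "\<forall>\<^sub>F k in sequentially. x - (1 / real (Suc k)) *\<^sub>R (x - c) \<in> \<Omega> \<and> y - (1 / real (Suc k)) *\<^sub>R (y - c) \<in> \<Omega>
       \<and> \<bar>?S (x - (1 / real (Suc k)) *\<^sub>R (x - c)) (y - (1 / real (Suc k)) *\<^sub>R (y - c))\<bar>
         \<le> (norm (y - (1 / real (Suc k)) *\<^sub>R (y - c) - (x - (1 / real (Suc k)) *\<^sub>R (x - c))))\<^sup>2"
      by (rule always_eventually, intro allI conjI inner mem xy subsetD[OF interior_subset])
  qed
qed

section \<open>Functions with zero data\<close>

lemma nonincreasing_on_Icc: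
  fixes F :: "real \<Rightarrow> real"
  assumes "a \<le> b" and d: "\<And>t. t \<in> {a..b} \<Longrightarrow> (F has_real_derivative F' t) (at t within {a..b})"
    and "\<And>t. t \<in> {a..b} \<Longrightarrow> F' t \<le> 0"
  shows "F b \<le> F a"
proof (rule DERIV_nonpos_imp_decreasing_open[OF \<open>a \<le> b\<close>])
  fix t assume t: "a < t" "t < b"
  then show "\<exists>y. (F has_real_derivative y) (at t) \<and> y \<le> 0"
    using d[of t] assms(3)[of t] by (auto simp: at_within_Icc_at)
qed (rule DERIV_continuous_on[OF d])

lemma abs_le_on_Icc:
  fixes F :: "real \<Rightarrow> real"
  assumes "a \<le> b" and d: "\<And>t. t \<in> {a..b} \<Longrightarrow> (F has_real_derivative F' t) (at t within {a..b})"
    and B: "\<And>t. t \<in> {a..b} \<Longrightarrow> \<bar>F' t\<bar> \<le> M"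
  shows "\<bar>F b - F a\<bar> \<le> M * (b - a)"
proof -
  have "F b - M * b \<le> F a - M * a"
  proof (rule nonincreasing_on_Icc[OF \<open>a \<le> b\<close>, where F' = "\<lambda>t. F' t - M"])
    fix t assume t: "t \<in> {a..b}"
    show "((\<lambda>t. F t - M * t) has_real_derivative F' t - M) (at t within {a..b})"
      using d[OF t] by (auto intro!: derivative_eq_intros)
    show "F' t - M \<le> 0" using B[OF t] by linarith
  qed
  moreover have "- F b - M * b \<le> - F a - M * a"
  proof (rule nonincreasing_on_Icc[OF \<open>a \<le> b\<close>, where F' = "\<lambda>t. - F' t - M"])
    fix t assume t: "t \<in> {a..b}"
    show "((\<lambda>t. - F t - M * t) has_real_derivative - F' t - M) (at t within {a..b})"
      using d[OF t] by (auto intro!: derivative_eq_intros)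
    show "- F' t - M \<le> 0" using B[OF t] by linarith
  qed
  ultimately show ?thesis by (simp add: abs_le_iff algebra_simps)
qed

text \<open>A bootstrap on the maximum M of |\<psi>|. Since \<phi> starts at 0, it is at most M s,
  so the hypothesis \<open>gap\<close> makes \<psi> Lipschitz with constant 2 + e M, where e = |p| +
  |q| s. As \<psi> starts at 0 too, this gives M \<le> (2 + e M) s, hence M \<le> 4 s for small s;
  inserting that again leaves the constant 2 + 4 s e.\<close>

lemma zero_jet_derivative_lipschitz:
  fixes \<phi> \<psi> :: "real \<Rightarrow> real"
  assumes s: "0 < s" and small: "s * (\<bar>p\<bar> + \<bar>q\<bar> * s) \<le> 1/2"
    and d: "\<And>t. t \<in> {0..s} \<Longrightarrow> (\<phi> has_real_derivative \<psi> t) (at t within {0..s})"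
    and c: "continuous_on {0..s} \<psi>" and zero: "\<phi> 0 = 0" "\<psi> 0 = 0"
    and gap: "\<And>a b B. 0 \<le> a \<Longrightarrow> a < b \<Longrightarrow> b \<le> s \<Longrightarrow> (\<And>t. t \<in> {0..s} \<Longrightarrow> \<bar>\<phi> t\<bar> \<le> B) \<Longrightarrow>
      \<bar>\<psi> b - \<psi> a\<bar> \<le> (b - a) * (2 + \<bar>q\<bar> * B) + \<bar>p\<bar> * \<bar>\<phi> b - \<phi> a\<bar>"
    and ab: "0 \<le> a" "a \<le> b" "b \<le> s"
  shows "\<bar>\<psi> b - \<psi> a\<bar> \<le> (2 + 4 * (s * (\<bar>p\<bar> + \<bar>q\<bar> * s))) * (b - a)"
proof -
  define e where "e = \<bar>p\<bar> + \<bar>q\<bar> * s"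
  have e: "0 \<le> e" using s by (simp add: e_def)
  obtain tm where tm: "tm \<in> {0..s}" "\<And>t. t \<in> {0..s} \<Longrightarrow> \<bar>\<psi> t\<bar> \<le> \<bar>\<psi> tm\<bar>"
  proof -
    have "continuous_on {0..s} (\<lambda>t. \<bar>\<psi> t\<bar>)" by (intro continuous_intros c)
    from continuous_attains_sup[OF compact_Icc _ this] show ?thesis using that s by fastforce
  qed
  define M where "M = \<bar>\<psi> tm\<bar>"
  have M0: "0 \<le> M" by (simp add: M_def)
  have inc: "\<bar>\<phi> b - \<phi> a\<bar> \<le> M * (b - a)" if "0 \<le> a" "a \<le> b" "b \<le> s" for a b
  proof (rule abs_le_on_Icc[OF that(2)])
    fix t assume "t \<in> {a..b}"
    then have t: "t \<in> {0..s}" using that by auto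
    show "(\<phi> has_real_derivative \<psi> t) (at t within {a..b})"
      by (rule DERIV_subset[OF d[OF t]]) (use that in auto)
    show "\<bar>\<psi> t\<bar> \<le> M" using tm(2)[OF t] by (simp add: M_def)
  qed
  have bd: "\<bar>\<phi> t\<bar> \<le> M * s" if "t \<in> {0..s}" for t
  proof -
    have "\<bar>\<phi> t\<bar> \<le> M * t" using inc[of 0 t] that zero by simp
    also have "\<dots> \<le> M * s" using that M0 by (intro mult_left_mono) auto
    finally show ?thesis .
  qed
  have step: "\<bar>\<psi> b - \<psi> a\<bar> \<le> (2 + e * M) * (b - a)" if ab: "0 \<le> a" "a \<le> b" "b \<le> s" for a b
  proof (cases "a = b")
    case False
    have "\<bar>\<psi> b - \<psi> a\<bar> \<le> (b - a) * (2 + \<bar>q\<bar> * (M * s)) + \<bar>p\<bar> * \<bar>\<phi> b - \<phi> a\<bar>"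
      using ab False by (intro gap bd) auto
    also have "\<bar>p\<bar> * \<bar>\<phi> b - \<phi> a\<bar> \<le> \<bar>p\<bar> * (M * (b - a))"
      by (intro mult_left_mono inc ab) auto
    finally show ?thesis by (simp add: e_def algebra_simps)
  qed simp
  have "M \<le> (2 + e * M) * tm" using step[of 0 tm] tm(1) zero by (simp add: M_def)
  also have "\<dots> \<le> (2 + e * M) * s" using tm(1) e M0 by (intro mult_left_mono) auto
  also have "\<dots> = 2 * s + (s * e) * M" by (simp add: algebra_simps)
  \<comment> \<open>The smallness hypothesis serves to absorb this half of M into the left-hand
    side.\<close>
  also have "\<dots> \<le> 2 * s + 1/2 * M" using small M0 by (intro add_left_mono mult_right_mono) (auto simp: e_def)
  finally have "M \<le> 4 * s" by simp
  then have "e * M \<le> e * (4 * s)" using e by (rule mult_left_mono)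
  then have "(2 + e * M) * (b - a) \<le> (2 + 4 * (s * e)) * (b - a)"
    using ab by (intro mult_right_mono) (auto simp: algebra_simps)
  with step[OF ab] show ?thesis by (simp add: e_def)
qed

text \<open>With \<psi> = 0 at one end, \<psi> t \<le> \<Lambda> t, with integral \<Lambda> s^2 / 2.
  With \<psi> = 0 at both ends, \<psi> t \<le> \<Lambda> min(t, s - t), a tent with integral
  \<Lambda> s^2 / 4; hence the splitting at s / 2. This halving is the gain at interior
  maxima.\<close>

lemma zero_jet_bound:
  fixes \<phi> \<psi> :: "real \<Rightarrow> real"
  assumes s: "0 < s"
    and d: "\<And>t. t \<in> {0..s} \<Longrightarrow> (\<phi> has_real_derivative \<psi> t) (at t within {0..s})"
    and zero: "\<phi> 0 = 0" "\<psi> 0 = 0"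
    and lip: "\<And>a b. 0 \<le> a \<Longrightarrow> a \<le> b \<Longrightarrow> b \<le> s \<Longrightarrow> \<bar>\<psi> b - \<psi> a\<bar> \<le> \<Lambda> * (b - a)"
  shows "\<phi> s \<le> \<Lambda> * s\<^sup>2 / 2" and "\<psi> s = 0 \<Longrightarrow> \<phi> s \<le> \<Lambda> * s\<^sup>2 / 4"
proof -
  have part: "\<phi> b \<le> \<Lambda> * b\<^sup>2 / 2" if b: "0 \<le> b" "b \<le> s" for b
  proof -
    have "\<phi> b - \<Lambda> * b\<^sup>2 / 2 \<le> \<phi> 0 - \<Lambda> * 0\<^sup>2 / 2"
    proof (rule nonincreasing_on_Icc[OF b(1), where F' = "\<lambda>t. \<psi> t - \<Lambda> * t"])
      fix t assume t: "t \<in> {0..b}"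
      have "(\<phi> has_real_derivative \<psi> t) (at t within {0..b})"
        by (rule DERIV_subset[OF d]) (use t b in auto)
      then show "((\<lambda>t. \<phi> t - \<Lambda> * t\<^sup>2 / 2) has_real_derivative \<psi> t - \<Lambda> * t) (at t within {0..b})"
        by (auto intro!: derivative_eq_intros)
      show "\<psi> t - \<Lambda> * t \<le> 0" using lip[of 0 t] t b zero by auto
    qed
    then show ?thesis using zero by simp
  qed
  then show "\<phi> s \<le> \<Lambda> * s\<^sup>2 / 2" using s by simp
  assume end0: "\<psi> s = 0"
  have "\<phi> s + \<Lambda> * (s - s)\<^sup>2 / 2 \<le> \<phi> (s/2) + \<Lambda> * (s - s/2)\<^sup>2 / 2"
  proof (rule nonincreasing_on_Icc[where F = "\<lambda>t. \<phi> t + \<Lambda> * (s - t)\<^sup>2 / 2" and F' = "\<lambda>t. \<psi> t - \<Lambda> * (s - t)"])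
    fix t assume t: "t \<in> {s/2..s}"
    have "(\<phi> has_real_derivative \<psi> t) (at t within {s/2..s})"
      by (rule DERIV_subset[OF d]) (use t s in auto)
    then show "((\<lambda>t. \<phi> t + \<Lambda> * (s - t)\<^sup>2 / 2) has_real_derivative \<psi> t - \<Lambda> * (s - t)) (at t within {s/2..s})"
      by (auto intro!: derivative_eq_intros simp: field_simps)
    show "\<psi> t - \<Lambda> * (s - t) \<le> 0" using lip[of t s] t s end0 by auto
  qed (use s in auto)
  also have "\<phi> (s/2) \<le> \<Lambda> * (s/2)\<^sup>2 / 2" using part[of "s/2"] s by simp
  finally show "\<phi> s \<le> \<Lambda> * s\<^sup>2 / 4" by (simp add: power2_eq_square field_simps)
qed

lemma seg_gap_estimate:
  assumes gap: "\<bar>seg_gap p q g h x y\<bar> \<le> C * (norm (y - x))\<^sup>2"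
    and cont: "continuous_on {0..1} (\<lambda>s. h (x + s *\<^sub>R (y - x)))"
    and B: "\<And>s. s \<in> {0..1} \<Longrightarrow> \<bar>h (x + s *\<^sub>R (y - x))\<bar> \<le> B"
  shows "\<bar>(g y - g x) \<bullet> (y - x)\<bar> \<le> (norm (y - x))\<^sup>2 * (C + \<bar>q\<bar> * B) + \<bar>p\<bar> * norm (y - x) * \<bar>h y - h x\<bar>"
proof -
  let ?I = "integral {0..1} (\<lambda>s. h (x + s *\<^sub>R (y - x)))"
  have "norm ?I \<le> B * (1 - 0)" by (rule integral_bound[OF _ cont]) (use B in auto)
  then have I: "\<bar>?I\<bar> \<le> B" by simp
  have "\<bar>q * (norm (y - x))\<^sup>2 * ?I\<bar> \<le> \<bar>q\<bar> * (norm (y - x))\<^sup>2 * B"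
    unfolding abs_mult using I by (auto intro!: mult_mono)
  moreover have "\<bar>p * norm (y - x) * (h y - h x)\<bar> = \<bar>p\<bar> * norm (y - x) * \<bar>h y - h x\<bar>"
    by (simp add: abs_mult)
  moreover have "(norm (y - x))\<^sup>2 * (C + \<bar>q\<bar> * B) = C * (norm (y - x))\<^sup>2 + \<bar>q\<bar> * (norm (y - x))\<^sup>2 * B"
    by (simp add: algebra_simps)
  ultimately show ?thesis using gap unfolding seg_gap_def by linarith
qed

section \<open>Differences of two members of the class\<close>

text \<open>Made for h = f1 - f2 with both functions in the class, where the bounds 1 and 1 add up
  to 2. The field \<open>g\<close> is a parameter rather than \<open>grad \<Omega> h\<close>, so
  that the difference of two gradients can be inserted directly.\<close>

locale seg_bounded =
  fixes \<Omega> :: "'a::euclidean_space set" and p q :: real and h :: "'a \<Rightarrow> real" and g :: "'a \<Rightarrow> 'a"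
  assumes body: "convex_body \<Omega>"
    and deriv: "\<And>x. x \<in> \<Omega> \<Longrightarrow> (h has_derivative (\<lambda>v. g x \<bullet> v)) (at x within \<Omega>)"
    and cont_g: "continuous_on \<Omega> g"
    and gap: "\<And>x y. x \<in> \<Omega> \<Longrightarrow> y \<in> \<Omega> \<Longrightarrow> \<bar>seg_gap p q g h x y\<bar> \<le> 2 * (norm (y - x))\<^sup>2"
begin

lemma convex: "convex \<Omega>" and compact: "compact \<Omega>"
  using body by (auto simp: convex_body_def)

lemma cont_h: "continuous_on \<Omega> h"
  using deriv by (rule has_derivative_continuous_on)

lemma seg_in: "x \<in> \<Omega> \<Longrightarrow> y \<in> \<Omega> \<Longrightarrow> 0 \<le> t \<Longrightarrow> t \<le> 1 \<Longrightarrow> x + t *\<^sub>R (y - x) \<in> \<Omega>"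
  by (rule convex_segment_mem[OF convex])

lemma estimate:
  assumes "x \<in> \<Omega>" "y \<in> \<Omega>" and "\<And>s. s \<in> {0..1} \<Longrightarrow> \<bar>h (x + s *\<^sub>R (y - x))\<bar> \<le> B"
  shows "\<bar>(g y - g x) \<bullet> (y - x)\<bar> \<le> (norm (y - x))\<^sup>2 * (2 + \<bar>q\<bar> * B) + \<bar>p\<bar> * norm (y - x) * \<bar>h y - h x\<bar>"
proof (rule seg_gap_estimate[OF gap[OF assms(1,2)] _ assms(3)])
  show "continuous_on {0..1} (\<lambda>s. h (x + s *\<^sub>R (y - x)))"
    by (rule continuous_on_compose2[OF cont_h]) (use assms seg_in in \<open>auto intro!: continuous_intros\<close>)
qed

text \<open>The segment from the node z to x, parametrised by arc length, reduces this to the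
  estimates in one variable with \<Lambda> = 2 + 4 s (|p| + |q| s); \<Lambda> / 2 and \<Lambda> / 4
  are the two constants, enlarged from s to r.\<close>

lemma bound_from_node:
  assumes z: "z \<in> \<Omega>" "h z = 0" "g z = 0" and x: "x \<in> \<Omega>"
    and sr: "norm (x - z) \<le> r" and small: "r * (\<bar>p\<bar> + \<bar>q\<bar> * r) \<le> 1/2"
  shows "h x \<le> (1 + 2 * (r * (\<bar>p\<bar> + \<bar>q\<bar> * r))) * (norm (x - z))\<^sup>2"
    and "g x = 0 \<Longrightarrow> h x \<le> (1 + 2 * (r * (\<bar>p\<bar> + \<bar>q\<bar> * r))) * (norm (x - z))\<^sup>2 / 2"
proof -
  define s where "s = norm (x - z)"
  have le: "s * (\<bar>p\<bar> + \<bar>q\<bar> * s) \<le> r * (\<bar>p\<bar> + \<bar>q\<bar> * r)"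
    using sr order_trans[OF norm_ge_zero sr] by (auto intro!: mult_mono add_mono simp: s_def)
  have *: "h x \<le> (1 + 2 * (s * (\<bar>p\<bar> + \<bar>q\<bar> * s))) * s\<^sup>2 \<and> (g x = 0 \<longrightarrow> h x \<le> (1 + 2 * (s * (\<bar>p\<bar> + \<bar>q\<bar> * s))) * s\<^sup>2 / 2)"
  proof (cases "s = 0")
    case True
    then have "x = z" by (simp add: s_def)
    then show ?thesis using z by (simp add: s_def)
  next
    case False
    then have s: "s > 0" by (simp add: s_def)
    define u where "u = (x - z) /\<^sub>R s"
    have u: "norm u = 1" "s *\<^sub>R u = x - z" using s by (auto simp: u_def s_def)
    have mem: "z + t *\<^sub>R u \<in> \<Omega>" if "t \<in> {0..s}" for t
    proof -
      have "z + (t / s) *\<^sub>R (x - z) \<in> \<Omega>" using that s by (intro seg_in z x) auto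
      then show ?thesis using s by (simp add: u_def divide_inverse)
    qed
    define \<phi> where "\<phi> t = h (z + t *\<^sub>R u)" for t
    define \<psi> where "\<psi> t = g (z + t *\<^sub>R u) \<bullet> u" for t
    have d: "(\<phi> has_real_derivative \<psi> t) (at t within {0..s})" if "t \<in> {0..s}" for t
      unfolding \<phi>_def[abs_def] \<psi>_def
      by (rule has_real_derivative_along_segment[OF deriv mem that])
    have c: "continuous_on {0..s} \<psi>" unfolding \<psi>_def[abs_def]
      by (intro continuous_intros continuous_on_compose2[OF cont_g]) (use mem in auto)
    have zero: "\<phi> 0 = 0" "\<psi> 0 = 0" using z by (auto simp: \<phi>_def \<psi>_def)
    have gp: "\<bar>\<psi> b - \<psi> a\<bar> \<le> (b - a) * (2 + \<bar>q\<bar> * B) + \<bar>p\<bar> * \<bar>\<phi> b - \<phi> a\<bar>"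
      if ab: "0 \<le> a" "a < b" "b \<le> s" and B: "\<And>t. t \<in> {0..s} \<Longrightarrow> \<bar>\<phi> t\<bar> \<le> B" for a b B
    proof -
      let ?x = "z + a *\<^sub>R u" and ?y = "z + b *\<^sub>R u"
      have xy: "?y - ?x = (b - a) *\<^sub>R u" by (simp add: algebra_simps)
      have nm: "norm (?y - ?x) = b - a" unfolding xy using u ab by simp
      have "\<bar>(g ?y - g ?x) \<bullet> (?y - ?x)\<bar> \<le> (norm (?y - ?x))\<^sup>2 * (2 + \<bar>q\<bar> * B) + \<bar>p\<bar> * norm (?y - ?x) * \<bar>h ?y - h ?x\<bar>"
      proof (rule estimate)
        show "?x \<in> \<Omega>" "?y \<in> \<Omega>" using mem ab by auto
        fix t :: real assume t: "t \<in> {0..1}"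
        have eq: "?x + t *\<^sub>R (?y - ?x) = z + (a + t * (b - a)) *\<^sub>R u" unfolding xy by (simp add: algebra_simps)
        have m: "a + t * (b - a) \<in> {0..s}"
        proof -
          have "0 \<le> t * (b - a)" "t * (b - a) \<le> b - a" using t ab by (auto intro!: mult_left_le_one_le)
          then show ?thesis using ab unfolding atLeastAtMost_iff by linarith
        qed
        show "\<bar>h (?x + t *\<^sub>R (?y - ?x))\<bar> \<le> B" unfolding eq using B[OF m] by (simp only: \<phi>_def)
      qed
      moreover have "\<bar>(g ?y - g ?x) \<bullet> (?y - ?x)\<bar> = (b - a) * \<bar>\<psi> b - \<psi> a\<bar>"
        unfolding xy inner_scaleR_right abs_mult inner_diff_left using ab by (simp add: \<psi>_def)
      \<comment> \<open>\<open>seg_gap\<close> carries one factor of the length more than the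
        increment of the derivative; it is cancelled below, as a < b.\<close>
      ultimately have "(b - a) * \<bar>\<psi> b - \<psi> a\<bar> \<le> (b - a)\<^sup>2 * (2 + \<bar>q\<bar> * B) + \<bar>p\<bar> * (b - a) * \<bar>\<phi> b - \<phi> a\<bar>"
        unfolding nm by (simp only: \<phi>_def)
      also have "\<dots> = (b - a) * ((b - a) * (2 + \<bar>q\<bar> * B) + \<bar>p\<bar> * \<bar>\<phi> b - \<phi> a\<bar>)"
        by (simp only: power2_eq_square distrib_left mult_ac)
      finally have "(b - a) * \<bar>\<psi> b - \<psi> a\<bar> \<le> (b - a) * ((b - a) * (2 + \<bar>q\<bar> * B) + \<bar>p\<bar> * \<bar>\<phi> b - \<phi> a\<bar>)" .
      then show ?thesis using ab by simp
    qed
    have lip: "\<bar>\<psi> b - \<psi> a\<bar> \<le> (2 + 4 * (s * (\<bar>p\<bar> + \<bar>q\<bar> * s))) * (b - a)" if "0 \<le> a" "a \<le> b" "b \<le> s" for a b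
      by (rule zero_jet_derivative_lipschitz[OF s _ d c zero gp that]) (use le small in auto)
    have end1: "\<phi> s = h x" "g x = 0 \<Longrightarrow> \<psi> s = 0" using u by (auto simp: \<phi>_def \<psi>_def)
    have "(2 + 4 * c) * s\<^sup>2 / 2 = (1 + 2 * c) * s\<^sup>2" "(2 + 4 * c) * s\<^sup>2 / 4 = (1 + 2 * c) * s\<^sup>2 / 2" for c
      by (auto simp: field_simps)
    then show ?thesis using zero_jet_bound[OF s d zero lip] end1 by metis
  qed
  have mono: "(1 + 2 * (s * (\<bar>p\<bar> + \<bar>q\<bar> * s))) * s\<^sup>2 \<le> (1 + 2 * (r * (\<bar>p\<bar> + \<bar>q\<bar> * r))) * s\<^sup>2"
    using le by (intro mult_right_mono) auto
  show "h x \<le> (1 + 2 * (r * (\<bar>p\<bar> + \<bar>q\<bar> * r))) * (norm (x - z))\<^sup>2"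
    using * mono by (simp add: s_def)
  show "h x \<le> (1 + 2 * (r * (\<bar>p\<bar> + \<bar>q\<bar> * r))) * (norm (x - z))\<^sup>2 / 2" if "g x = 0"
    using * mono that by (simp add: s_def)
qed

text \<open>At a general x the gradient of h need not vanish and only the weaker of the two node
  bounds would apply. Bounding h at its global maximum, and every other value by that one, is what
  makes the stronger bound available.\<close>

lemma bound_from_nodes:
  assumes nodes: "\<And>z. z \<in> \<xi> \<Longrightarrow> z \<in> \<Omega> \<and> h z = 0 \<and> g z = 0"
    and r: "0 < r" and small: "r * (\<bar>p\<bar> + \<bar>q\<bar> * r) \<le> 1/2"
    and cover: "\<And>x. x \<in> \<Omega> \<Longrightarrow> \<exists>z\<in>\<xi>. dist x z \<le> r"
    and boundary: "\<And>x. x \<in> \<Omega> - interior \<Omega> \<Longrightarrow> \<exists>z\<in>\<xi>. dist x z \<le> r / 2"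
    and x: "x \<in> \<Omega>"
  shows "h x \<le> (1 + 2 * (r * (\<bar>p\<bar> + \<bar>q\<bar> * r))) * r\<^sup>2 / 2"
proof -
  define \<kappa> where "\<kappa> = 1 + 2 * (r * (\<bar>p\<bar> + \<bar>q\<bar> * r))"
  have \<kappa>: "\<kappa> \<ge> 0" using r by (simp add: \<kappa>_def)
  obtain m where m: "m \<in> \<Omega>" "\<And>y. y \<in> \<Omega> \<Longrightarrow> h y \<le> h m"
    using continuous_attains_sup[OF compact _ cont_h] x by blast
  have "h m \<le> \<kappa> * r\<^sup>2 / 2"
  proof (cases "m \<in> interior \<Omega>")
    case True
    have dm: "(h has_derivative (\<lambda>v. g m \<bullet> v)) (at m)"
      using deriv[OF m(1)] unfolding at_within_interior[OF True] .
    have "(\<lambda>v. g m \<bullet> v) = (\<lambda>v. 0)"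
      by (rule differential_zero_maxmin[OF True open_interior dm]) (use m(2) interior_subset[of \<Omega>] in auto)
    from fun_cong[OF this, of "g m"] have g0: "g m = 0" by simp
    obtain z where z: "z \<in> \<xi>" "norm (m - z) \<le> r" using cover[OF m(1)] by (auto simp: dist_norm)
    have "h m \<le> \<kappa> * (norm (m - z))\<^sup>2 / 2"
      unfolding \<kappa>_def using nodes[OF z(1)] by (intro bound_from_node(2) m z small g0) auto
    also have "\<dots> \<le> \<kappa> * r\<^sup>2 / 2"
      using \<kappa> z by (intro divide_right_mono mult_left_mono power_mono) auto
    finally show ?thesis .
  next
    case False
    obtain z where z: "z \<in> \<xi>" "norm (m - z) \<le> r/2" using boundary m(1) False by (auto simp: dist_norm)
    have "h m \<le> \<kappa> * (norm (m - z))\<^sup>2"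
      unfolding \<kappa>_def using nodes[OF z(1)] r z by (intro bound_from_node(1) m small) auto
    also have "\<dots> \<le> \<kappa> * (r/2)\<^sup>2"
      using \<kappa> z by (intro mult_left_mono power_mono) auto
    \<comment> \<open>Halving the distance divides the one-sided bound by 4, which outweighs its
      missing factor 1/2.\<close>
    also have "\<dots> \<le> \<kappa> * r\<^sup>2 / 2" using \<kappa> by (simp add: power2_eq_square)
    finally show ?thesis .
  qed
  then show ?thesis using m(2)[OF x] by (simp add: \<kappa>_def)
qed

text \<open>By the mean value theorem some point z of the segment satisfies g z \<bullet> (y - x) =
  h y - h x, and the segment inequality from x to z controls the change of g in this direction.
  Differentiation happens only along segments of \<Omega>, so x may be a boundary point.\<close>

lemma directional_bound:
  assumes B: "\<And>x. x \<in> \<Omega> \<Longrightarrow> \<bar>h x\<bar> \<le> B" and \<Delta>: "\<And>x y. x \<in> \<Omega> \<Longrightarrow> y \<in> \<Omega> \<Longrightarrow> norm (y - x) \<le> \<Delta>"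
    and xy: "x \<in> \<Omega>" "y \<in> \<Omega>"
  shows "\<bar>g x \<bullet> (y - x)\<bar> \<le> 2 * B + (\<Delta>\<^sup>2 * (2 + \<bar>q\<bar> * B) + 2 * \<bar>p\<bar> * \<Delta> * B)"
proof -
  let ?n = "norm (y - x)"
  have B0: "0 \<le> B" using B[OF xy(1)] by linarith
  have seg: "x + t *\<^sub>R (y - x) \<in> \<Omega>" if "t \<in> {0..1}" for t using seg_in[OF xy] that by auto
  have d: "((\<lambda>t. h (x + t *\<^sub>R (y - x))) has_real_derivative g (x + t *\<^sub>R (y - x)) \<bullet> (y - x)) (at t within {0..1})"
    if "t \<in> {0..1}" for t
    by (rule has_real_derivative_along_segment[OF deriv seg that])
  obtain t where t: "t \<in> {0<..<1}"
    "h (x + 1 *\<^sub>R (y - x)) - h (x + 0 *\<^sub>R (y - x)) = (1 - 0) * (g (x + t *\<^sub>R (y - x)) \<bullet> (y - x))"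
    using mvt_simple[of 0 1 "\<lambda>t. h (x + t *\<^sub>R (y - x))" "\<lambda>t s. s * (g (x + t *\<^sub>R (y - x)) \<bullet> (y - x))"] d
    by (auto simp: has_field_derivative_def mult_commute_abs)
  let ?z = "x + t *\<^sub>R (y - x)"
  have z: "?z \<in> \<Omega>" using seg t by auto
  have "\<bar>(g ?z - g x) \<bullet> (?z - x)\<bar> \<le> (norm (?z - x))\<^sup>2 * (2 + \<bar>q\<bar> * B) + \<bar>p\<bar> * norm (?z - x) * \<bar>h ?z - h x\<bar>"
    by (rule estimate[OF xy(1) z]) (use B seg_in[OF xy(1) z] in auto)
  \<comment> \<open>Since z - x = t (y - x), a factor t can be split off from both sides; t > 0
    because the mean value point is interior to the segment.\<close>
  then have "t * \<bar>(g ?z - g x) \<bullet> (y - x)\<bar> \<le> t * (t * ?n\<^sup>2 * (2 + \<bar>q\<bar> * B) + \<bar>p\<bar> * ?n * \<bar>h ?z - h x\<bar>)"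
  proof -
    assume *: "\<bar>(g ?z - g x) \<bullet> (?z - x)\<bar> \<le> (norm (?z - x))\<^sup>2 * (2 + \<bar>q\<bar> * B) + \<bar>p\<bar> * norm (?z - x) * \<bar>h ?z - h x\<bar>"
    have zx: "?z - x = t *\<^sub>R (y - x)" by simp
    have nz: "norm (?z - x) = t * ?n" unfolding zx norm_scaleR using t(1) by simp
    have "\<bar>(g ?z - g x) \<bullet> (?z - x)\<bar> = t * \<bar>(g ?z - g x) \<bullet> (y - x)\<bar>"
      unfolding zx inner_scaleR_right abs_mult using t(1) by simp
    with * have "t * \<bar>(g ?z - g x) \<bullet> (y - x)\<bar> \<le> (t * ?n)\<^sup>2 * (2 + \<bar>q\<bar> * B) + \<bar>p\<bar> * (t * ?n) * \<bar>h ?z - h x\<bar>"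
      unfolding nz by simp
    also have "\<dots> = t * (t * ?n\<^sup>2 * (2 + \<bar>q\<bar> * B) + \<bar>p\<bar> * ?n * \<bar>h ?z - h x\<bar>)"
      by (simp only: power2_eq_square distrib_left mult_ac)
    finally show ?thesis .
  qed
  then have "\<bar>(g ?z - g x) \<bullet> (y - x)\<bar> \<le> t * ?n\<^sup>2 * (2 + \<bar>q\<bar> * B) + \<bar>p\<bar> * ?n * \<bar>h ?z - h x\<bar>"
    using t(1) by simp
  also have "t * ?n\<^sup>2 * (2 + \<bar>q\<bar> * B) \<le> 1 * \<Delta>\<^sup>2 * (2 + \<bar>q\<bar> * B)"
    using t(1) \<Delta>[OF xy] B0 by (intro mult_right_mono mult_mono power_mono) auto
  also have "\<bar>p\<bar> * ?n * \<bar>h ?z - h x\<bar> \<le> \<bar>p\<bar> * \<Delta> * (2 * B)"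
  proof -
    have "\<bar>h ?z - h x\<bar> \<le> 2 * B" using B[OF z] B[OF xy(1)] by linarith
    then show ?thesis using \<Delta>[OF xy] order_trans[OF norm_ge_zero \<Delta>[OF xy]] by (intro mult_mono) auto
  qed
  finally have 1: "\<bar>(g ?z - g x) \<bullet> (y - x)\<bar> \<le> \<Delta>\<^sup>2 * (2 + \<bar>q\<bar> * B) + 2 * \<bar>p\<bar> * \<Delta> * B" by simp
  have "g ?z \<bullet> (y - x) = h y - h x" using t(2) by simp
  then have "\<bar>g ?z \<bullet> (y - x)\<bar> \<le> 2 * B" using B[OF xy(1)] B[OF xy(2)] by linarith
  with 1 show ?thesis unfolding inner_diff_left by linarith
qed

text \<open>The directional bounds towards c + w and c - w, with w of length \<rho> parallel to g x,
  have difference 2 (g x \<bullet> w) = 2 \<rho> |g x|. The size of the constant is irrelevant: it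
  has to be common to all pairs of functions with equal data, so that the envelopes are
  continuous.\<close>

lemma lipschitz:
  assumes B: "\<And>x. x \<in> \<Omega> \<Longrightarrow> \<bar>h x\<bar> \<le> B" and \<Delta>: "\<And>x y. x \<in> \<Omega> \<Longrightarrow> y \<in> \<Omega> \<Longrightarrow> norm (y - x) \<le> \<Delta>"
    and \<rho>: "0 < \<rho>" "cball c \<rho> \<subseteq> \<Omega>"
  shows "((2 * B + (\<Delta>\<^sup>2 * (2 + \<bar>q\<bar> * B) + 2 * \<bar>p\<bar> * \<Delta> * B)) / \<rho>)-lipschitz_on \<Omega> h"
proof -
  define K where "K = 2 * B + (\<Delta>\<^sup>2 * (2 + \<bar>q\<bar> * B) + 2 * \<bar>p\<bar> * \<Delta> * B)"
  have dir: "\<bar>g x \<bullet> (y - x)\<bar> \<le> K" if "x \<in> \<Omega>" "y \<in> \<Omega>" for x y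
    unfolding K_def by (rule directional_bound) (use B \<Delta> that in auto)
  have g: "norm (g x) \<le> K / \<rho>" if x: "x \<in> \<Omega>" for x
  proof (cases "g x = 0")
    case False
    let ?w = "(\<rho> / norm (g x)) *\<^sub>R g x"
    have y: "c + ?w \<in> \<Omega>" "c - ?w \<in> \<Omega>"
      using \<rho> False by (auto intro!: subsetD[OF \<rho>(2)] simp: dist_norm)
    have "2 * (g x \<bullet> ?w) = g x \<bullet> (c + ?w - x) - g x \<bullet> (c - ?w - x)" by (simp add: inner_diff_right inner_add_right)
    also have "\<dots> \<le> 2 * K" using dir[OF x y(1)] dir[OF x y(2)] by linarith
    finally have "\<rho> * norm (g x) \<le> K" using False by (simp add: dot_square_norm power2_eq_square)
    then show ?thesis using \<rho> by (simp add: field_simps)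
  next
    case True
    have "0 \<le> K" using dir[OF x x] by simp
    then show ?thesis using True \<rho> by simp
  qed
  have "(K / \<rho>)-lipschitz_on \<Omega> h"
  proof (rule bounded_derivative_imp_lipschitz[OF deriv convex])
    fix x assume x: "x \<in> \<Omega>"
    show "onorm (\<lambda>v. g x \<bullet> v) \<le> K / \<rho>"
    proof (rule onorm_le)
      fix v have "norm (g x \<bullet> v) \<le> norm (g x) * norm v" by (simp add: Cauchy_Schwarz_ineq2)
      also have "\<dots> \<le> K / \<rho> * norm v" using g[OF x] by (rule mult_right_mono) simp
      finally show "norm (g x \<bullet> v) \<le> K / \<rho> * norm v" .
    qed
  next
    have "c \<in> \<Omega>" using \<rho> by auto
    from order_trans[OF norm_ge_zero g[OF this]] show "0 \<le> K / \<rho>" .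
  qed
  then show ?thesis by (simp add: K_def)
qed

end

lemma W_class_diff_seg_bounded:
  assumes \<Omega>: "convex_body \<Omega>" and f: "f1 \<in> W_class p q \<Omega>" "f2 \<in> W_class p q \<Omega>"
  shows "seg_bounded \<Omega> p q (\<lambda>x. f1 x - f2 x) (\<lambda>x. grad \<Omega> f1 x - grad \<Omega> f2 x)"
proof
  have C1: "C1_on \<Omega> f1" "C1_on \<Omega> f2" using f by (auto simp: W_class_def)
  note g1 = C1_on_grad[OF \<Omega> C1(1)] and g2 = C1_on_grad[OF \<Omega> C1(2)]
  show "convex_body \<Omega>" by fact
  show "continuous_on \<Omega> (\<lambda>x. grad \<Omega> f1 x - grad \<Omega> f2 x)"
    using g1(1) g2(1) by (intro continuous_intros)
  fix x assume x: "x \<in> \<Omega>"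
  show "((\<lambda>x. f1 x - f2 x) has_derivative (\<lambda>v. (grad \<Omega> f1 x - grad \<Omega> f2 x) \<bullet> v)) (at x within \<Omega>)"
    using g1(2)[OF x] g2(2)[OF x] by (auto intro!: derivative_eq_intros simp: inner_diff_left)
  fix y assume y: "y \<in> \<Omega>"
  have cvx: "convex \<Omega>" using \<Omega> by (simp add: convex_body_def)
  have seg: "x + s *\<^sub>R (y - x) \<in> \<Omega>" if "s \<in> {0..1}" for s
    using convex_segment_mem[OF cvx x y] that by auto
  have int: "(\<lambda>s. f (x + s *\<^sub>R (y - x))) integrable_on {0..1}" if "continuous_on \<Omega> f" for f :: "'a \<Rightarrow> real"
    by (intro integrable_continuous_real continuous_on_compose2[OF that] continuous_intros) (use seg in auto)
  have "seg_gap p q (\<lambda>x. grad \<Omega> f1 x - grad \<Omega> f2 x) (\<lambda>x. f1 x - f2 x) x y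
      = seg_gap p q (grad \<Omega> f1) f1 x y - seg_gap p q (grad \<Omega> f2) f2 x y"
    unfolding seg_gap_def integral_diff[OF int[OF g1(3)] int[OF g2(3)]]
    by (simp add: algebra_simps inner_diff_left inner_diff_right)
  then show "\<bar>seg_gap p q (\<lambda>x. grad \<Omega> f1 x - grad \<Omega> f2 x) (\<lambda>x. f1 x - f2 x) x y\<bar> \<le> 2 * (norm (y - x))\<^sup>2"
    using W_class_seg_gap[OF \<Omega> f(1) x y] W_class_seg_gap[OF \<Omega> f(2) x y] by linarith
qed

section \<open>The error of the midpoint algorithm\<close>

lemma lipschitz_on_SUP:
  fixes k :: "'b \<Rightarrow> 'a::metric_space \<Rightarrow> real"
  assumes ne: "F \<noteq> {}" and lip: "\<And>f. f \<in> F \<Longrightarrow> L-lipschitz_on S (k f)"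
    and bdd: "\<And>x. x \<in> S \<Longrightarrow> bdd_above ((\<lambda>f. k f x) ` F)"
  shows "L-lipschitz_on S (\<lambda>x. SUP f\<in>F. k f x)"
proof (rule lipschitz_onI)
  have one: "(SUP f\<in>F. k f x) \<le> (SUP f\<in>F. k f y) + L * dist x y" if "x \<in> S" "y \<in> S" for x y
  proof (rule cSUP_least[OF ne])
    fix f assume f: "f \<in> F"
    have "k f x \<le> k f y + L * dist x y"
      using lipschitz_onD[OF lip[OF f] that] by (simp add: dist_real_def abs_le_iff)
    also have "k f y \<le> (SUP f\<in>F. k f y)" by (rule cSUP_upper[OF f bdd[OF that(2)]])
    finally show "k f x \<le> (SUP f\<in>F. k f y) + L * dist x y" by simp
  qed
  fix x y assume xy: "x \<in> S" "y \<in> S"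
  show "dist (SUP f\<in>F. k f x) (SUP f\<in>F. k f y) \<le> L * dist x y"
    using one[OF xy] one[OF xy(2,1)] by (simp add: dist_real_def dist_commute abs_le_iff)
next
  show "0 \<le> L" using ne lip lipschitz_on_nonneg by blast
qed

text \<open>Only differences are assumed to be Lipschitz, so envelopes are taken relative to a fixed
  f0: f0 + U is the upper one, f0 - V the lower one, and f0 + (U - V) / 2 their midpoint. Its error
  is at most (U + V) / 2, and U + V \<le> 2 E because any two members differ by at most 2 E.\<close>

lemma continuous_midpoint:
  fixes F :: "('a::metric_space \<Rightarrow> real) set"
  assumes f0: "f0 \<in> F" "continuous_on S f0"
    and close: "\<And>f1 f2 x. f1 \<in> F \<Longrightarrow> f2 \<in> F \<Longrightarrow> x \<in> S \<Longrightarrow> f1 x - f2 x \<le> 2 * E"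
    and lip: "\<And>f1 f2. f1 \<in> F \<Longrightarrow> f2 \<in> F \<Longrightarrow> L-lipschitz_on S (\<lambda>x. f1 x - f2 x)"
  shows "\<exists>c. continuous_on S c \<and> (\<forall>f\<in>F. \<forall>x\<in>S. \<bar>f x - c x\<bar> \<le> E)"
proof -
  have ne: "F \<noteq> {}" using f0 by auto
  define U where "U x = (SUP f\<in>F. f x - f0 x)" for x
  define V where "V x = (SUP f\<in>F. f0 x - f x)" for x
  have bU: "bdd_above ((\<lambda>f. f x - f0 x) ` F)" if "x \<in> S" for x
    using close f0(1) that by (intro bdd_aboveI2[of _ _ "2 * E"]) auto
  have bV: "bdd_above ((\<lambda>f. f0 x - f x) ` F)" if "x \<in> S" for x
    using close f0(1) that by (intro bdd_aboveI2[of _ _ "2 * E"]) auto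
  have "L-lipschitz_on S U" "L-lipschitz_on S V"
    unfolding U_def V_def by (rule lipschitz_on_SUP[OF ne lip bU], use f0 in auto)
      (rule lipschitz_on_SUP[OF ne lip bV], use f0 in auto)
  then have "continuous_on S U" "continuous_on S V" by (auto intro: lipschitz_on_continuous_on)
  with f0(2) have "continuous_on S (\<lambda>x. f0 x + (U x - V x) / 2)"
    by (intro continuous_intros) auto
  moreover have "\<bar>f x - (f0 x + (U x - V x) / 2)\<bar> \<le> E" if f: "f \<in> F" and x: "x \<in> S" for f x
  proof -
    have 1: "f x - f0 x \<le> U x" unfolding U_def by (rule cSUP_upper[OF f bU[OF x]])
    have 2: "f0 x - f x \<le> V x" unfolding V_def by (rule cSUP_upper[OF f bV[OF x]])
    have "U x \<le> 2 * E - V x" unfolding U_def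
    proof (rule cSUP_least[OF ne])
      fix f1 assume f1: "f1 \<in> F"
      have "V x \<le> 2 * E - (f1 x - f0 x)" unfolding V_def
      proof (rule cSUP_least[OF ne])
        fix f2 assume "f2 \<in> F"
        then show "f0 x - f2 x \<le> 2 * E - (f1 x - f0 x)" using close[OF f1 _ x] by (simp add: algebra_simps)
      qed
      then show "f1 x - f0 x \<le> 2 * E - V x" by simp
    qed
    with 1 2 show ?thesis by (simp add: abs_le_iff field_simps)
  qed
  ultimately show ?thesis by blast
qed

lemma rec_err_le:
  fixes \<Omega> :: "'a::euclidean_space set"
  assumes \<Omega>: "convex_body \<Omega>" and \<xi>: "\<xi> \<subseteq> \<Omega>" and r: "0 < r" and small: "r * (\<bar>p\<bar> + \<bar>q\<bar> * r) \<le> 1/2"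
    and cover: "\<And>x. x \<in> \<Omega> \<Longrightarrow> \<exists>z\<in>\<xi>. dist x z \<le> r"
    and boundary: "\<And>x. x \<in> \<Omega> - interior \<Omega> \<Longrightarrow> \<exists>z\<in>\<xi>. dist x z \<le> r / 2"
  shows "rec_err p q \<Omega> \<xi> \<le> ereal ((1 + 2 * (r * (\<bar>p\<bar> + \<bar>q\<bar> * r))) * r\<^sup>2 / 4)"
proof -
  \<comment> \<open>Half of the bound of \<open>bound_from_nodes\<close>: the midpoint halves the
    width of the envelopes.\<close>
  define E where "E = (1 + 2 * (r * (\<bar>p\<bar> + \<bar>q\<bar> * r))) * r\<^sup>2 / 4"
  have cpt: "compact \<Omega>" using \<Omega> by (simp add: convex_body_def)
  obtain x0 \<rho>0 where "\<rho>0 > 0" "cball x0 \<rho>0 \<subseteq> \<Omega>"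
    using \<Omega> unfolding convex_body_def by (metis all_not_in_conv mem_interior_cball)
  note \<rho> = this
  obtain \<Delta> where "\<forall>x\<in>\<Omega>. \<forall>y\<in>\<Omega>. dist x y \<le> \<Delta>"
    using compact_imp_bounded[OF cpt] unfolding bounded_two_points by blast
  then have \<Delta>: "\<And>x y. x \<in> \<Omega> \<Longrightarrow> y \<in> \<Omega> \<Longrightarrow> norm (y - x) \<le> \<Delta>"
    by (simp add: dist_norm norm_minus_commute)
  define L where "L = (2 * (2 * E) + (\<Delta>\<^sup>2 * (2 + \<bar>q\<bar> * (2 * E)) + 2 * \<bar>p\<bar> * \<Delta> * (2 * E))) / \<rho>0"
  have "\<exists>c. continuous_on \<Omega> c \<and> (\<forall>f\<in>{f \<in> W_class p q \<Omega>. info \<Omega> f \<xi> = I}. \<forall>x\<in>\<Omega>. \<bar>f x - c x\<bar> \<le> E)" for I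
  proof (cases "{f \<in> W_class p q \<Omega>. info \<Omega> f \<xi> = I} = {}")
    case True
    \<comment> \<open>An algorithm must return a continuous function also for data that no member of
      the class produces; any constant will do.\<close>
    then show ?thesis by (metis continuous_on_const empty_iff)
  next
    case False
    let ?F = "{f \<in> W_class p q \<Omega>. info \<Omega> f \<xi> = I}"
    obtain f0 where f0: "f0 \<in> ?F" using False by blast
    have sb: "seg_bounded \<Omega> p q (\<lambda>x. f1 x - f2 x) (\<lambda>x. grad \<Omega> f1 x - grad \<Omega> f2 x)"
      if "f1 \<in> ?F" "f2 \<in> ?F" for f1 f2
      using that by (intro W_class_diff_seg_bounded[OF \<Omega>]) auto
    have le: "f1 x - f2 x \<le> 2 * E" if f: "f1 \<in> ?F" "f2 \<in> ?F" and x: "x \<in> \<Omega>" for f1 f2 x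
    proof -
      interpret seg_bounded \<Omega> p q "\<lambda>x. f1 x - f2 x" "\<lambda>x. grad \<Omega> f1 x - grad \<Omega> f2 x"
        by (rule sb[OF f])
      have "f1 x - f2 x \<le> (1 + 2 * (r * (\<bar>p\<bar> + \<bar>q\<bar> * r))) * r\<^sup>2 / 2"
      proof (rule bound_from_nodes[OF _ r small cover boundary x])
        fix z assume z: "z \<in> \<xi>"
        have "info \<Omega> f1 \<xi> z = info \<Omega> f2 \<xi> z" using f by simp
        then show "z \<in> \<Omega> \<and> f1 z - f2 z = 0 \<and> grad \<Omega> f1 z - grad \<Omega> f2 z = 0"
          using z \<xi> by (auto simp: info_def)
      qed
      then show ?thesis unfolding E_def by linarith
    qed
    show ?thesis
    proof (rule continuous_midpoint[OF f0])
      show "continuous_on \<Omega> f0" using f0 C1_on_grad(3)[OF \<Omega>] by (auto simp: W_class_def)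
      show "f1 x - f2 x \<le> 2 * E" if "f1 \<in> ?F" "f2 \<in> ?F" "x \<in> \<Omega>" for f1 f2 x by (rule le[OF that])
      show "L-lipschitz_on \<Omega> (\<lambda>x. f1 x - f2 x)" if f: "f1 \<in> ?F" "f2 \<in> ?F" for f1 f2
        unfolding L_def
      proof (rule seg_bounded.lipschitz[OF sb[OF f] _ \<Delta> \<rho>])
        fix x assume "x \<in> \<Omega>"
        then show "\<bar>f1 x - f2 x\<bar> \<le> 2 * E" using le[OF f] le[OF f(2,1)] by (simp add: abs_le_iff)
      qed
    qed
  qed
  then obtain \<phi> where \<phi>: "\<And>I. continuous_on \<Omega> (\<phi> I)"
    "\<And>f x. f \<in> W_class p q \<Omega> \<Longrightarrow> x \<in> \<Omega> \<Longrightarrow> \<bar>f x - \<phi> (info \<Omega> f \<xi>) x\<bar> \<le> E"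
    by (metis (mono_tags, lifting) mem_Collect_eq)
  have "rec_err p q \<Omega> \<xi> \<le> (SUP f\<in>W_class p q \<Omega>. SUP x\<in>\<Omega>. ereal \<bar>f x - \<phi> (info \<Omega> f \<xi>) x\<bar>)"
    unfolding rec_err_def by (rule INF_lower) (use \<phi>(1) in simp)
  also have "\<dots> \<le> ereal E" using \<phi>(2) by (intro SUP_least) simp
  finally show ?thesis by (simp add: E_def)
qed

section \<open>Coverings and node sets\<close>

text \<open>The lower corner of the half-open cell of the grid s Z^d that contains x. Representing
  cells by corners makes "in the same cell" an equation and the set of cells meeting S an image of
  S.\<close>

definition cell_corner :: "real \<Rightarrow> 'a::euclidean_space \<Rightarrow> 'a" where
  "cell_corner s x = (\<Sum>b\<in>Basis. (s * of_int \<lfloor>x \<bullet> b / s\<rfloor>) *\<^sub>R b)"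

lemma cell_corner_inner:
  "b \<in> Basis \<Longrightarrow> cell_corner s x \<bullet> b = s * of_int \<lfloor>x \<bullet> b / s\<rfloor>"
  by (simp add: cell_corner_def inner_sum_left_Basis)

lemma cell_corner_bounds:
  assumes "s > 0" "b \<in> Basis"
  shows "cell_corner s x \<bullet> b \<le> x \<bullet> b" "x \<bullet> b < cell_corner s x \<bullet> b + s"
proof -
  have "s * of_int \<lfloor>x \<bullet> b / s\<rfloor> \<le> s * (x \<bullet> b / s)" "s * (x \<bullet> b / s) < s * (of_int \<lfloor>x \<bullet> b / s\<rfloor> + 1)"
    using assms(1) by (intro mult_left_mono mult_strict_left_mono; linarith)+
  then show "cell_corner s x \<bullet> b \<le> x \<bullet> b" "x \<bullet> b < cell_corner s x \<bullet> b + s"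
    using assms by (auto simp: cell_corner_inner distrib_left)
qed

lemma cell_corner_eqI:
  fixes x y :: "'a::euclidean_space"
  assumes s: "s > 0" and y: "\<And>b. b \<in> Basis \<Longrightarrow> cell_corner s x \<bullet> b \<le> y \<bullet> b \<and> y \<bullet> b < cell_corner s x \<bullet> b + s"
  shows "cell_corner s y = cell_corner s x"
proof (rule euclidean_eqI)
  fix b :: 'a assume b: "b \<in> Basis"
  have "s * of_int \<lfloor>x \<bullet> b / s\<rfloor> \<le> y \<bullet> b" "y \<bullet> b < s * of_int \<lfloor>x \<bullet> b / s\<rfloor> + s"
    using y[OF b] cell_corner_inner[OF b, of s x] by auto
  then have "of_int \<lfloor>x \<bullet> b / s\<rfloor> \<le> y \<bullet> b / s" "y \<bullet> b / s < of_int \<lfloor>x \<bullet> b / s\<rfloor> + 1"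
    using s by (auto simp: field_simps)
  then have "\<lfloor>y \<bullet> b / s\<rfloor> = \<lfloor>x \<bullet> b / s\<rfloor>" by (simp add: floor_eq_iff)
  then show "cell_corner s y \<bullet> b = cell_corner s x \<bullet> b" using b by (simp add: cell_corner_inner)
qed

lemma cell_corner_idem: "s > 0 \<Longrightarrow> cell_corner s (cell_corner s x) = cell_corner s x"
  by (rule cell_corner_eqI) auto

lemma dist_le_DIM_mult:
  fixes x y :: "'a::euclidean_space"
  assumes "\<And>b. b \<in> Basis \<Longrightarrow> \<bar>x \<bullet> b - y \<bullet> b\<bar> \<le> s"
  shows "dist x y \<le> real DIM('a) * s"
proof -
  have "norm (x - y) \<le> (\<Sum>b\<in>Basis. \<bar>(x - y) \<bullet> b\<bar>)" by (rule norm_le_l1)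
  also have "\<dots> \<le> (\<Sum>b\<in>(Basis :: 'a set). s)" using assms by (intro sum_mono) (simp add: inner_diff_left)
  finally show ?thesis by (simp add: dist_norm)
qed

lemma dist_same_cell:
  fixes x y :: "'a::euclidean_space"
  assumes s: "s > 0" and eq: "cell_corner s x = cell_corner s y"
  shows "dist x y \<le> real DIM('a) * s"
proof (rule dist_le_DIM_mult)
  fix b :: 'a assume "b \<in> Basis"
  then show "\<bar>x \<bullet> b - y \<bullet> b\<bar> \<le> s"
    using cell_corner_bounds[OF s, of b x] cell_corner_bounds[OF s, of b y] eq by (simp add: abs_le_iff)
qed

lemma emeasure_lborel_shifted_box:
  fixes c :: "'a::euclidean_space"
  assumes "s > 0"
  shows "emeasure lborel (box c (c + s *\<^sub>R One)) = ennreal (s ^ DIM('a))"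
proof -
  have "(\<Prod>b\<in>(Basis :: 'a set). (c + s *\<^sub>R One - c) \<bullet> b) = (\<Prod>b\<in>(Basis :: 'a set). s)"
    by (intro prod.cong) auto
  then show ?thesis using assms
    by (subst emeasure_lborel_box) (auto simp: inner_add_left)
qed

text \<open>A volume argument: every cell meeting S lies in M, because \<open>DIM('a) * s\<close>
  bounds the diameter of a cell, and the open cells are disjoint of volume s^d. Finiteness follows
  since the same bound holds for all finite subfamilies.\<close>

lemma cell_count:
  fixes S :: "'a::euclidean_space set"
  assumes s: "s > 0" and M: "M \<in> fmeasurable lborel"
    and nbhd: "\<And>x y. x \<in> S \<Longrightarrow> dist x y \<le> real DIM('a) * s \<Longrightarrow> y \<in> M"
  shows "finite (cell_corner s ` S)" and "real (card (cell_corner s ` S)) * s ^ DIM('a) \<le> measure lborel M"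
proof -
  let ?B = "\<lambda>c. box c (c + s *\<^sub>R One) :: 'a set"
  have inB: "cell_corner s y = c" if cy: "c \<in> cell_corner s ` S" "y \<in> ?B c" for c y
  proof -
    obtain x where c: "c = cell_corner s x" using cy by blast
    have "cell_corner s y = cell_corner s x"
      by (rule cell_corner_eqI[OF s]) (use cy c in \<open>auto simp: mem_box inner_add_left less_imp_le\<close>)
    then show ?thesis using c by simp
  qed
  have sub: "?B c \<subseteq> M" if "c \<in> cell_corner s ` S" for c
  proof
    fix y assume y: "y \<in> ?B c"
    obtain x where "x \<in> S" "c = cell_corner s x" using \<open>c \<in> cell_corner s ` S\<close> by blast
    then show "y \<in> M" using inB[OF that y] dist_same_cell[OF s, of x y] nbhd by simp
  qed
  have fin: "real (card G) * s ^ DIM('a) \<le> measure lborel M" if G: "G \<subseteq> cell_corner s ` S" "finite G" for G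
  proof -
    have "disjoint_family_on ?B G"
      unfolding disjoint_family_on_def
    proof (intro ballI impI equals0I)
      fix c c' y assume "c \<in> G" "c' \<in> G" "c \<noteq> c'" "y \<in> ?B c \<inter> ?B c'"
      then show False using inB[of c y] inB[of c' y] subsetD[OF G(1)] by simp
    qed
    then have "(\<Sum>c\<in>G. emeasure lborel (?B c)) = emeasure lborel (\<Union>c\<in>G. ?B c)"
      using G by (intro sum_emeasure) auto
    also have "\<dots> \<le> emeasure lborel M" 
    proof (rule emeasure_mono)
      show "(\<Union>c\<in>G. ?B c) \<subseteq> M" by (intro UN_least sub subsetD[OF G(1)])
    qed (use M in \<open>auto simp: fmeasurable_def\<close>)
    also have "\<dots> = ennreal (measure lborel M)" using M by (intro emeasure_eq_ennreal_measure) (auto simp: fmeasurable_def)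
    finally have "of_nat (card G) * ennreal (s ^ DIM('a)) \<le> ennreal (measure lborel M)"
      using s by (simp add: emeasure_lborel_shifted_box)
    then have "ennreal (real (card G) * s ^ DIM('a)) \<le> ennreal (measure lborel M)"
      using s by (simp add: ennreal_mult ennreal_of_nat_eq_real_of_nat)
    then show ?thesis by simp
  qed
  show f: "finite (cell_corner s ` S)"
  proof (rule finite_if_finite_subsets_card_bdd[where C = "nat \<lceil>measure lborel M / s ^ DIM('a)\<rceil>", THEN conjunct1])
    fix G assume "G \<subseteq> cell_corner s ` S" "finite G"
    then have "real (card G) * s ^ DIM('a) \<le> measure lborel M" by (rule fin)
    then have "real (card G) \<le> measure lborel M / s ^ DIM('a)" using s by (simp add: field_simps)
    then show "card G \<le> nat \<lceil>measure lborel M / s ^ DIM('a)\<rceil>" by linarith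
  qed
  show "real (card (cell_corner s ` S)) * s ^ DIM('a) \<le> measure lborel M"
    by (rule fin[OF order_refl f])
qed

section \<open>Cubes, balls and finiteness of the covering density\<close>

lemma emeasure_lborel_cube:
  assumes "R \<ge> 0"
  shows "emeasure lborel (cube R :: 'a::euclidean_space set) = ennreal ((2 * R) ^ DIM('a))"
proof -
  have "(\<Prod>b\<in>(Basis :: 'a set). (R *\<^sub>R One - (- (R *\<^sub>R One))) \<bullet> b) = (\<Prod>b\<in>(Basis :: 'a set). 2 * R)"
    by (intro prod.cong) (auto simp: inner_add_left inner_diff_left)
  then show ?thesis using assms unfolding cube_def
    by (subst emeasure_lborel_cbox) (auto simp: inner_add_left)
qed

lemma mem_cube: "x \<in> cube R \<longleftrightarrow> (\<forall>b\<in>Basis. \<bar>x \<bullet> b\<bar> \<le> R)"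
  by (auto simp: cube_def mem_box abs_le_iff)

lemma cube_fmeasurable: "cube R \<in> fmeasurable lborel"
  by (simp add: cube_def fmeasurable_cbox)

lemma mem_cube_near:
  assumes "x \<in> cube R" "dist x y \<le> d"
  shows "y \<in> cube (R + d)"
  unfolding mem_cube
proof
  fix b :: 'a assume b: "b \<in> Basis"
  have "\<bar>(x - y) \<bullet> b\<bar> \<le> d" using Basis_le_norm[OF b, of "x - y"] assms(2) by (simp add: dist_norm)
  moreover have "\<bar>x \<bullet> b\<bar> \<le> R" using assms(1) b by (simp add: mem_cube)
  ultimately show "\<bar>y \<bullet> b\<bar> \<le> R + d" by (simp add: inner_diff_left)
qed

lemma emeasure_lborel_cball:
  fixes c :: "'a::euclidean_space"
  assumes "r \<ge> 0"
  shows "emeasure lborel (cball c r) = ennreal (measure lborel (ball (0::'a) 1) * r ^ DIM('a))"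
proof -
  have "emeasure lborel (cball c r) = ennreal (measure lborel (cball c r))"
    using emeasure_bounded_finite[OF bounded_cball, of c r] by (intro emeasure_eq_ennreal_measure) auto
  then show ?thesis using assms by (simp add: content_cball content_ball)
qed

text \<open>Serves only as a covering whose density is visibly finite.\<close>

lemma integer_lattice_covering:
  "covering (range (cell_corner 1) :: 'a::euclidean_space set) (real DIM('a))"
  unfolding covering_def
proof (intro conjI)
  have "range (cell_corner 1) = (\<Union>k::nat. cell_corner 1 ` (cube (real k) :: 'a set))"
  proof -
    have "\<exists>k::nat. x \<in> cube (real k)" for x :: 'a
    proof -
      obtain k :: nat where "norm x \<le> real k" using real_arch_simple by blast
      then show ?thesis by (auto simp: mem_cube intro!: exI[of _ k] order_trans[OF Basis_le_norm])
    qed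
    then show ?thesis by blast
  qed
  moreover have "finite (cell_corner 1 ` (cube (real k) :: 'a set))" for k :: nat
    by (rule cell_count(1)[OF _ cube_fmeasurable]) (auto intro: mem_cube_near)
  ultimately show "countable (range (cell_corner 1) :: 'a set)"
    by (simp add: countable_finite)
  have "x \<in> cball (cell_corner 1 x) (real DIM('a))" for x :: 'a
    using dist_same_cell[of 1 "cell_corner 1 x" x] by (simp add: cell_corner_idem)
  then show "(\<Union>c\<in>range (cell_corner 1). cball c (real DIM('a))) = (UNIV :: 'a set)" by blast
qed simp

text \<open>With d the dimension, balls meeting \<open>cube R\<close> have centres in
  \<open>cube (R + d)\<close>, so there are at most (2 (R + 2 d))^d of them. For R \<ge> 2 d this is
  at most 2^d times the volume of \<open>cube R\<close>, and each ball contributes at most its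
  volume \<open>K\<close>.\<close>

lemma cov_dens_integer_lattice_finite:
  "cov_dens (range (cell_corner 1) :: 'a::euclidean_space set) (real DIM('a)) < \<infinity>"
proof -
  let ?C = "range (cell_corner 1) :: 'a set" and ?d = "real DIM('a)"
  define K where "K = measure lborel (ball (0::'a) 1) * ?d ^ DIM('a)"
  have d: "?d > 0" by simp
  have K0: "K \<ge> 0" by (simp add: K_def)
  let ?X = "\<lambda>R. (\<Sum>\<^sub>\<infinity>c\<in>?C. emeasure lborel (cball c ?d \<inter> cube R)) / emeasure lborel (cube R :: 'a set)"
  have "?X R \<le> ennreal (2 ^ DIM('a) * K)" if R: "R \<ge> 2 * ?d" for R
  proof -
    let ?F = "cell_corner 1 ` (cube (R + ?d) :: 'a set)"
    have fin: "finite ?F" and card: "real (card ?F) * 1 ^ DIM('a) \<le> measure lborel (cube (R + ?d + ?d) :: 'a set)"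
      by (rule cell_count[OF zero_less_one cube_fmeasurable], erule mem_cube_near, simp)+
    have "(\<Sum>\<^sub>\<infinity>c\<in>?C. emeasure lborel (cball c ?d \<inter> cube R)) = (\<Sum>\<^sub>\<infinity>c\<in>?F. emeasure lborel (cball c ?d \<inter> cube R))"
    proof (rule infsum_cong_neutral)
      fix c :: 'a assume "c \<in> ?C - ?F"
      then have c: "c = cell_corner 1 c" "c \<notin> ?F" by (auto simp: cell_corner_idem)
      then have "c \<notin> cube (R + ?d)" by (metis imageI)
      then have "cball c ?d \<inter> cube R = {}" using mem_cube_near[of _ R c ?d] by (auto simp: dist_commute)
      then show "emeasure lborel (cball c ?d \<inter> cube R) = 0" by simp
    qed auto
    also have "\<dots> = (\<Sum>c\<in>?F. emeasure lborel (cball c ?d \<inter> cube R))" using fin by simp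
    also have "\<dots> \<le> (\<Sum>c\<in>?F. ennreal K)"
    proof (rule sum_mono)
      fix c :: 'a
      have "emeasure lborel (cball c ?d \<inter> cube R) \<le> emeasure lborel (cball c ?d)"
        by (intro emeasure_mono) auto
      then show "emeasure lborel (cball c ?d \<inter> cube R) \<le> ennreal K"
        by (simp add: emeasure_lborel_cball K_def)
    qed
    also have "\<dots> = ennreal (real (card ?F) * K)" 
      using K0 by (simp add: ennreal_mult ennreal_of_nat_eq_real_of_nat)
    also have "\<dots> \<le> ennreal ((2 ^ DIM('a) * K) * (2 * R) ^ DIM('a))"
    proof (rule ennreal_leI)
      have "measure lborel (cube (R + ?d + ?d) :: 'a set) = (2 * (R + ?d + ?d)) ^ DIM('a)"
        using R d by (simp add: measure_def emeasure_lborel_cube)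
      also have "\<dots> \<le> (2 * (2 * R)) ^ DIM('a)" using R d by (intro power_mono) auto
      finally have "real (card ?F) \<le> 2 ^ DIM('a) * (2 * R) ^ DIM('a)"
        using card unfolding power_mult_distrib[symmetric] by simp
      from mult_right_mono[OF this K0]
      show "real (card ?F) * K \<le> (2 ^ DIM('a) * K) * (2 * R) ^ DIM('a)" by (simp only: mult_ac)
    qed
    finally have le: "(\<Sum>\<^sub>\<infinity>c\<in>?C. emeasure lborel (cball c ?d \<inter> cube R)) \<le> ennreal ((2 ^ DIM('a) * K) * (2 * R) ^ DIM('a))" .
    have R0: "R > 0" using R d by linarith
    have pos: "(2 * R) ^ DIM('a) > 0" by (rule zero_less_power) (use R0 in simp)
    have "?X R \<le> ennreal ((2 ^ DIM('a) * K) * (2 * R) ^ DIM('a)) / ennreal ((2 * R) ^ DIM('a))"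
      using R0 le by (simp add: emeasure_lborel_cube divide_right_mono_ennreal)
    also have "\<dots> = ennreal (2 ^ DIM('a) * K)" using pos R0 K0 by (simp add: divide_ennreal)
    finally show ?thesis .
  qed
  then have "\<forall>\<^sub>F R in at_top. ?X R \<le> ennreal (2 ^ DIM('a) * K)"
    by (rule eventually_mono[OF eventually_ge_at_top])
  then have "Limsup at_top ?X \<le> ennreal (2 ^ DIM('a) * K)" by (rule Limsup_bounded)
  moreover have "Liminf at_top ?X \<le> Limsup at_top ?X" by (rule Liminf_le_Limsup) simp
  ultimately have "Liminf at_top ?X \<le> ennreal (2 ^ DIM('a) * K)" by (rule order_trans[rotated])
  also have "\<dots> < \<infinity>" by simp
  finally show ?thesis unfolding cov_dens_def .
qed

text \<open>Needed because \<open>enn2real \<infinity> = 0\<close>.\<close>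

lemma Theta_finite: "Theta TYPE('a::euclidean_space) < \<infinity>"
proof -
  have "Theta TYPE('a) \<le> cov_dens (fst (range (cell_corner 1) :: 'a set, real DIM('a))) (snd (range (cell_corner 1) :: 'a set, real DIM('a)))"
    unfolding Theta_def by (rule INF_lower) (simp add: integer_lattice_covering)
  then show ?thesis using cov_dens_integer_lattice_finite[where 'a = 'a] by (simp add: order_le_less_trans)
qed

section \<open>Almost optimal coverings of bounded sets\<close>

text \<open>Balls centred in \<open>cube (R - r0)\<close> lie inside \<open>cube R\<close> and count
  with full volume, and they already cover \<open>cube (R - 2 * r0)\<close>. The loss is the ratio
  of the two cubes, (1 - 2 r0 / R)^d, which the gap between D and D' absorbs once R is large. The
  lower limit in the density provides arbitrarily large R at which the quotient is below D.\<close>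

lemma finite_cube_cover:
  fixes C :: "'a::euclidean_space set"
  assumes cov: "covering C r0" and dens: "cov_dens C r0 < ennreal D" and D: "0 \<le> D" "D < D'"
  obtains a and P :: "'a set" where "a > 0" "finite P" "\<And>x. x \<in> cbox 0 (a *\<^sub>R One) \<Longrightarrow> \<exists>c\<in>P. dist x c \<le> r0"
    "real (card P) * (measure lborel (ball (0::'a) 1) * r0 ^ DIM('a)) \<le> D' * a ^ DIM('a)"
proof -
  let ?d = "DIM('a)"
  define \<nu> where "\<nu> = measure lborel (ball (0::'a) 1)"
  have r0: "r0 > 0" and UN: "(\<Union>c\<in>C. cball c r0) = UNIV" using cov by (auto simp: covering_def)
  have \<nu>: "\<nu> > 0" by (simp add: \<nu>_def content_ball)
  let ?X = "\<lambda>R. (\<Sum>\<^sub>\<infinity>c\<in>C. emeasure lborel (cball c r0 \<inter> cube R)) / emeasure lborel (cube R :: 'a set)"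
  have "((\<lambda>R. D' * (1 - 2 * r0 / R) ^ ?d) \<longlongrightarrow> D' * (1 - 0) ^ ?d) at_top"
    by (intro tendsto_intros tendsto_divide_0[OF tendsto_const filterlim_at_top_imp_at_infinity[OF filterlim_ident]])
  then have ev: "\<forall>\<^sub>F R in at_top. D < D' * (1 - 2 * r0 / R) ^ ?d"
    using D by (intro order_tendstoD(1)) auto
  have "\<exists>R. R > 2 * r0 \<and> D < D' * (1 - 2 * r0 / R) ^ ?d \<and> ?X R < ennreal D"
  proof (rule ccontr)
    assume *: "\<not> ?thesis"
    have "\<forall>\<^sub>F R in at_top. ennreal D \<le> ?X R"
      using ev eventually_gt_at_top[of "2 * r0"]
    proof eventually_elim
      case (elim R)
      then show ?case using * not_le by blast
    qed
    then have "ennreal D \<le> Liminf at_top ?X" by (rule Liminf_bounded)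
    then show False using dens unfolding cov_dens_def by simp
  qed
  then obtain R where R: "R > 2 * r0" and DR: "D < D' * (1 - 2 * r0 / R) ^ ?d" and X: "?X R < ennreal D" by blast
  have R0: "R > 0" using R r0 by linarith
  have pos: "(2 * R) ^ ?d > 0" using R0 by (intro zero_less_power) simp
  have S: "(\<Sum>\<^sub>\<infinity>c\<in>C. emeasure lborel (cball c r0 \<inter> cube R)) < ennreal (D * (2 * R) ^ ?d)"
  proof -
    have em: "emeasure lborel (cube R :: 'a set) = ennreal ((2 * R) ^ ?d)"
      using R0 by (intro emeasure_lborel_cube) simp
    have "ennreal ((2 * R) ^ ?d) \<noteq> 0" "ennreal ((2 * R) ^ ?d) < top"
      using pos by (auto simp only: ennreal_eq_0_iff not_le ennreal_less_top)
    from divide_less_ennreal[OF this, THEN iffD1, OF X[unfolded em]] show ?thesis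
      using D(1) pos by (simp only: ennreal_mult less_imp_le)
  qed
  define P0 where "P0 = C \<inter> cube (R - r0)"
  define a where "a = 2 * (R - 2 * r0)"
  have a: "a > 0" using R by (simp add: a_def)
  have count: "real (card F) * (\<nu> * r0 ^ ?d) \<le> D * (2 * R) ^ ?d" if F: "F \<subseteq> P0" "finite F" for F
  proof -
    have "ennreal (real (card F) * (\<nu> * r0 ^ ?d)) = (\<Sum>c\<in>F. ennreal (\<nu> * r0 ^ ?d))"
      using \<nu> r0 by (simp add: ennreal_mult ennreal_of_nat_eq_real_of_nat)
    also have "\<dots> = (\<Sum>c\<in>F. emeasure lborel (cball c r0 \<inter> cube R))"
    proof (rule sum.cong[OF refl])
      fix c assume "c \<in> F"
      then have c: "c \<in> cube (R - r0)" using F by (auto simp: P0_def)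
      have "cball c r0 \<subseteq> cube R" using mem_cube_near[OF c, of _ r0] by auto
      then have "cball c r0 \<inter> cube R = cball c r0" by blast
      then show "ennreal (\<nu> * r0 ^ ?d) = emeasure lborel (cball c r0 \<inter> cube R)"
        using r0 by (simp add: emeasure_lborel_cball \<nu>_def)
    qed
    also have "\<dots> \<le> (\<Sum>\<^sub>\<infinity>c\<in>C. emeasure lborel (cball c r0 \<inter> cube R))"
      by (subst nonneg_infsum_complete) (use F in \<open>auto simp: P0_def intro!: SUP_upper\<close>)
    also have "\<dots> \<le> ennreal (D * (2 * R) ^ ?d)" using S by simp
    finally show ?thesis using D(1) R0 by (subst (asm) ennreal_le_iff) auto
  qed
  have fin: "finite P0"
  proof (rule finite_if_finite_subsets_card_bdd[where C = "nat \<lceil>D * (2 * R) ^ ?d / (\<nu> * r0 ^ ?d)\<rceil>", THEN conjunct1])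
    fix G assume "G \<subseteq> P0" "finite G"
    from count[OF this] have "real (card G) \<le> D * (2 * R) ^ ?d / (\<nu> * r0 ^ ?d)"
      using \<nu> r0 by (simp add: pos_le_divide_eq)
    then show "card G \<le> nat \<lceil>D * (2 * R) ^ ?d / (\<nu> * r0 ^ ?d)\<rceil>" by linarith
  qed
  \<comment> \<open>Moves \<open>cube (R - 2 * r0)\<close> to the box with corner 0 and side a, the
    form in which it can be repeated over grid cells.\<close>
  let ?t = "(R - 2 * r0) *\<^sub>R One :: 'a"
  show ?thesis
  proof (rule that[of a "(\<lambda>c. c + ?t) ` P0"])
    show "a > 0" by fact
    show "finite ((\<lambda>c. c + ?t) ` P0)" using fin by simp
    fix x :: 'a assume x: "x \<in> cbox 0 (a *\<^sub>R One)"
    have xt: "x - ?t \<in> cube (R - 2 * r0)"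
      using x by (auto simp: mem_cube mem_box a_def inner_diff_left abs_le_iff)
    obtain c where c: "c \<in> C" "dist c (x - ?t) \<le> r0" using UN by (metis UNIV_I UN_E mem_cball)
    have "c \<in> cube (R - 2 * r0 + r0)" by (rule mem_cube_near[OF xt]) (use c in \<open>simp add: dist_commute\<close>)
    then have "c \<in> P0" using c by (simp add: P0_def)
    moreover have "dist x (c + ?t) \<le> r0" using c(2) by (simp add: dist_norm norm_minus_commute algebra_simps)
    ultimately show "\<exists>c\<in>(\<lambda>c. c + ?t) ` P0. dist x c \<le> r0" by blast
  next
    have "real (card ((\<lambda>c. c + ?t) ` P0)) * (\<nu> * r0 ^ ?d) \<le> real (card P0) * (\<nu> * r0 ^ ?d)"
      using \<nu> r0 card_image_le[OF fin] by (intro mult_right_mono) auto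
    also have "\<dots> \<le> D * (2 * R) ^ ?d" by (rule count[OF order_refl fin])
    also have "\<dots> \<le> (D' * (1 - 2 * r0 / R) ^ ?d) * (2 * R) ^ ?d" using DR pos by (intro mult_right_mono) auto
    also have "\<dots> = D' * ((1 - 2 * r0 / R) * (2 * R)) ^ ?d" by (simp only: power_mult_distrib mult.assoc)
    also have "(1 - 2 * r0 / R) * (2 * R) = a" using R0 by (simp add: a_def field_simps)
    finally show "real (card ((\<lambda>c. c + ?t) ` P0)) * (measure lborel (ball (0::'a) 1) * r0 ^ ?d) \<le> D' * a ^ ?d"
      by (simp add: \<nu>_def)
  qed
qed

text \<open>Every cell of side l a that meets S receives a copy of P scaled by l, so both the number
  of cells and the cost per cell are under control. The resulting centres need not lie in S.\<close>

lemma scaled_cube_cover: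
  fixes P S :: "'a::euclidean_space set"
  assumes a: "a > 0" and P: "finite P" "\<And>x. x \<in> cbox 0 (a *\<^sub>R One) \<Longrightarrow> \<exists>c\<in>P. dist x c \<le> r0"
    and card: "real (card P) * (\<nu> * r0 ^ DIM('a)) \<le> D' * a ^ DIM('a)" and "D' \<ge> 0" "\<nu> \<ge> 0" "r0 \<ge> 0"
    and l: "l > 0" and M: "M \<in> fmeasurable lborel"
    and nbhd: "\<And>x y. x \<in> S \<Longrightarrow> dist x y \<le> real DIM('a) * (l * a) \<Longrightarrow> y \<in> M"
  shows "\<exists>F. finite F \<and> (\<forall>x\<in>S. \<exists>c\<in>F. dist x c \<le> l * r0) \<and>
    real (card F) * (\<nu> * (l * r0) ^ DIM('a)) \<le> D' * measure lborel M"
proof -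
  define G where "G = cell_corner (l * a) ` S"
  have la: "l * a > 0" using l a by simp
  have G: "finite G" "real (card G) * (l * a) ^ DIM('a) \<le> measure lborel M"
    unfolding G_def using cell_count[OF la M nbhd] by auto
  define F where "F = (\<lambda>(g, c). g + l *\<^sub>R c) ` (G \<times> P)"
  have F: "finite F" using G P by (simp add: F_def)
  have "card F \<le> card (G \<times> P)" unfolding F_def using G P by (intro card_image_le) simp
  then have "real (card F) \<le> real (card G) * real (card P)" by (metis card_cartesian_product of_nat_le_iff of_nat_mult)
  then have "real (card F) * (\<nu> * (l * r0) ^ DIM('a)) \<le> (real (card G) * real (card P)) * (\<nu> * (l * r0) ^ DIM('a))"
    using assms(5-8) by (intro mult_right_mono) auto
  also have "\<dots> = (real (card G) * l ^ DIM('a)) * (real (card P) * (\<nu> * r0 ^ DIM('a)))"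
    by (simp only: power_mult_distrib mult_ac)
  also have "\<dots> \<le> (real (card G) * l ^ DIM('a)) * (D' * a ^ DIM('a))"
    using card l by (intro mult_left_mono) auto
  also have "\<dots> = D' * (real (card G) * (l * a) ^ DIM('a))"
    by (simp only: power_mult_distrib mult_ac)
  also have "\<dots> \<le> D' * measure lborel M" using G(2) \<open>D' \<ge> 0\<close> by (rule mult_left_mono)
  finally have "real (card F) * (\<nu> * (l * r0) ^ DIM('a)) \<le> D' * measure lborel M" .
  moreover have "\<exists>c\<in>F. dist x c \<le> l * r0" if x: "x \<in> S" for x
  proof -
    define g where "g = cell_corner (l * a) x"
    have "(1 / l) *\<^sub>R (x - g) \<in> cbox 0 (a *\<^sub>R One)"
      using cell_corner_bounds[OF la, of _ x] l
      by (auto simp: mem_box g_def inner_diff_left field_simps less_imp_le)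
    then obtain c where c: "c \<in> P" "dist ((1 / l) *\<^sub>R (x - g)) c \<le> r0" using P(2) by blast
    have "g + l *\<^sub>R c \<in> F" using c x by (auto simp: F_def G_def g_def)
    moreover have "dist x (g + l *\<^sub>R c) \<le> l * r0"
    proof -
      have "x - (g + l *\<^sub>R c) = l *\<^sub>R ((1 / l) *\<^sub>R (x - g) - c)" using l by (simp add: algebra_simps)
      then have "dist x (g + l *\<^sub>R c) = l * dist ((1 / l) *\<^sub>R (x - g)) c" using l by (simp add: dist_norm)
      then show ?thesis using c l by simp
    qed
    ultimately show ?thesis by blast
  qed
  ultimately show ?thesis using F by blast
qed

section \<open>Placing the nodes inside the body\<close>

text \<open>Outer regularity gives an open set of almost the same measure, and compactness gives it
  a uniform thickness d around S; cells of diameter below d that meet S then cost only e of extra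
  volume.\<close>

lemma compact_measure_nbhd:
  fixes S :: "'a::euclidean_space set"
  assumes "compact S" "e > 0"
  obtains U d where "d > 0" "U \<in> fmeasurable lborel" "measure lborel U \<le> measure lborel S + e"
    "\<And>x y. x \<in> S \<Longrightarrow> dist x y < d \<Longrightarrow> y \<in> U"
proof -
  have Sb: "S \<in> sets borel" using assms(1) by (simp add: borel_compact)
  obtain U where U: "open U" "S \<subseteq> U" "emeasure lborel (U - S) < ennreal e"
    using outer_regular_lborel[OF Sb assms(2)] by metis
  have fS: "emeasure lborel S < \<infinity>" using assms(1) by (intro emeasure_bounded_finite compact_imp_bounded)
  have "emeasure lborel U = emeasure lborel (S \<union> (U - S))" using U(2) by (simp add: Un_absorb1)
  also have "\<dots> \<le> emeasure lborel S + emeasure lborel (U - S)"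
    using Sb U(1) by (intro emeasure_subadditive) auto
  also have "\<dots> \<le> ennreal (measure lborel S) + ennreal e"
    using U(3) fS by (intro add_mono) (auto simp: emeasure_eq_ennreal_measure)
  also have "\<dots> = ennreal (measure lborel S + e)" using assms(2) by simp
  finally have le: "emeasure lborel U \<le> ennreal (measure lborel S + e)" .
  then have fU: "emeasure lborel U < \<infinity>" by (simp add: order_le_less_trans)
  obtain d where d: "d > 0" "(\<Union>x\<in>S. ball x d) \<subseteq> U"
    using compact_subset_open_imp_ball_epsilon_subset[OF assms(1) U(1,2)] .
  show ?thesis
  proof (rule that[OF d(1)])
    show "U \<in> fmeasurable lborel" using fU U(1) by (auto simp: fmeasurable_def)
    show "measure lborel U \<le> measure lborel S + e"
    proof -
      have "ennreal (measure lborel U) \<le> ennreal (measure lborel S + e)"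
        using le fU by (metis emeasure_eq_ennreal_measure infinity_ennreal_def less_irrefl)
      then show ?thesis using assms(2) by (subst (asm) ennreal_le_iff) auto
    qed
    show "y \<in> U" if "x \<in> S" "dist x y < d" for x y
    proof -
      have "y \<in> ball x d" using that by simp
      then show ?thesis using d(2) that(1) by blast
    qed
  qed
qed

text \<open>The net serves the whole layer of width r, not just the frontier, because it also has to
  replace covering centres that fall outside \<Omega>. Its points are chosen from \<Omega> itself,
  one in each cell meeting the layer. The crude factor (2 d)^d is harmless, as M can be taken of
  arbitrarily small measure around a null set.\<close>

lemma frontier_layer_net:
  fixes \<Omega> :: "'a::euclidean_space set"
  assumes r: "r > 0" and M: "M \<in> fmeasurable lborel"
    and nbhd: "\<And>x y. x \<in> frontier \<Omega> \<Longrightarrow> dist x y < 2 * r \<Longrightarrow> y \<in> M"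
  shows "\<exists>N\<subseteq>\<Omega>. finite N \<and> (\<forall>x\<in>\<Omega>. (\<exists>z\<in>frontier \<Omega>. dist x z \<le> r) \<longrightarrow> (\<exists>c\<in>N. dist x c \<le> r / 2)) \<and>
    real (card N) * r ^ DIM('a) \<le> measure lborel M * (2 * real DIM('a)) ^ DIM('a)"
proof -
  let ?d = "real DIM('a)"
  \<comment> \<open>Chosen so that a cell has diameter at most r / 2.\<close>
  define s where "s = r / (2 * ?d)"
  have d: "?d > 0" by simp
  have s: "s > 0" and ds: "?d * s = r / 2" using r d by (auto simp: s_def)
  define L where "L = {x\<in>\<Omega>. \<exists>z\<in>frontier \<Omega>. dist x z \<le> r}"
  have nb: "y \<in> M" if xL: "x \<in> L" and xy: "dist x y \<le> ?d * s" for x y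
  proof -
    obtain z where z: "z \<in> frontier \<Omega>" "dist x z \<le> r" using xL by (auto simp: L_def)
    have "dist z y \<le> dist x z + dist x y" by (metis dist_commute dist_triangle)
    also have "\<dots> < 2 * r" using z xy ds r by linarith
    finally show ?thesis by (rule nbhd[OF z(1)])
  qed
  note cnt = cell_count[OF s M nb]
  define pick where "pick c = (SOME x. x \<in> L \<and> cell_corner s x = c)" for c
  have pick: "pick c \<in> L \<and> cell_corner s (pick c) = c" if "c \<in> cell_corner s ` L" for c
    unfolding pick_def by (rule someI_ex) (use that in auto)
  define N where "N = pick ` cell_corner s ` L"
  have "N \<subseteq> \<Omega>" using pick by (auto simp: N_def L_def)
  moreover have "finite N" using cnt(1) by (simp add: N_def)
  moreover have "\<exists>c\<in>N. dist x c \<le> r / 2" if "x \<in> \<Omega>" "\<exists>z\<in>frontier \<Omega>. dist x z \<le> r" for x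
  proof -
    have x: "x \<in> L" using that by (simp add: L_def)
    then have "cell_corner s x = cell_corner s (pick (cell_corner s x))" using pick by simp
    from dist_same_cell[OF s this] show ?thesis using x ds by (auto simp: N_def)
  qed
  moreover have "real (card N) * r ^ DIM('a) \<le> measure lborel M * (2 * ?d) ^ DIM('a)"
  proof -
    have "real (card N) \<le> real (card (cell_corner s ` L))" unfolding N_def using cnt(1) by (simp add: card_image_le)
    then have "real (card N) * s ^ DIM('a) \<le> real (card (cell_corner s ` L)) * s ^ DIM('a)"
      using s by (intro mult_right_mono) auto
    also have "\<dots> \<le> measure lborel M" by (rule cnt(2))
    finally have "real (card N) * s ^ DIM('a) * (2 * ?d) ^ DIM('a) \<le> measure lborel M * (2 * ?d) ^ DIM('a)"
      by (intro mult_right_mono) auto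
    moreover have "s * (2 * ?d) = r" by (simp add: s_def)
    ultimately show ?thesis by (metis mult.assoc power_mult_distrib)
  qed
  ultimately show ?thesis by blast
qed

text \<open>Of the scaled covering only the centres in \<Omega> are kept. If the centre c near x
  lies outside, the segment from x to c crosses the frontier within distance r of x, so x is in the
  layer served by the net. The net also provides the nodes at distance r / 2 from boundary
  points.\<close>

lemma node_set_exists:
  fixes \<Omega> :: "'a::euclidean_space set"
  assumes \<Omega>: "convex_body \<Omega>" and Th: "Theta TYPE('a) < ennreal D" and D: "0 \<le> D" "D < D'" and \<tau>: "\<tau> > 0"
  obtains \<rho> where "\<rho> > 0" "\<And>r. 0 < r \<Longrightarrow> r < \<rho> \<Longrightarrow> \<exists>\<xi>\<subseteq>\<Omega>. finite \<xi> \<and> (\<forall>x\<in>\<Omega>. \<exists>z\<in>\<xi>. dist x z \<le> r) \<and>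
      (\<forall>x\<in>\<Omega> - interior \<Omega>. \<exists>z\<in>\<xi>. dist x z \<le> r / 2) \<and>
      real (card \<xi>) * (measure lborel (ball (0::'a) 1) * r ^ DIM('a)) \<le> D' * (measure lborel \<Omega> + \<tau>) + \<tau>"
proof -
  let ?d = "real DIM('a)"
  define \<nu> where "\<nu> = measure lborel (ball (0::'a) 1)"
  have \<nu>: "\<nu> > 0" by (simp add: \<nu>_def content_ball)
  have cpt: "compact \<Omega>" and cvx: "convex \<Omega>" using \<Omega> by (auto simp: convex_body_def)
  obtain C r0 where C: "covering C r0" "cov_dens (C :: 'a set) r0 < ennreal D"
    using Th unfolding Theta_def INF_less_iff by auto
  have r0: "r0 > 0" using C(1) by (simp add: covering_def)
  obtain a and P :: "'a set" where a: "a > 0" and P: "finite P" "\<And>x. x \<in> cbox 0 (a *\<^sub>R One) \<Longrightarrow> \<exists>c\<in>P. dist x c \<le> r0"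
    "real (card P) * (\<nu> * r0 ^ DIM('a)) \<le> D' * a ^ DIM('a)"
    using finite_cube_cover[OF C D] unfolding \<nu>_def by metis
  obtain U d1 where U: "d1 > 0" "U \<in> fmeasurable lborel" "measure lborel U \<le> measure lborel \<Omega> + \<tau>"
    "\<And>x y. x \<in> \<Omega> \<Longrightarrow> dist x y < d1 \<Longrightarrow> y \<in> U"
    using compact_measure_nbhd[OF cpt \<tau>] by metis
  \<comment> \<open>Normalised so that the net contributes at most \<tau> to the final
    count.\<close>
  define \<tau>' where "\<tau>' = \<tau> / (\<nu> * (2 * ?d) ^ DIM('a))"
  have \<tau>': "\<tau>' > 0" using \<tau> \<nu> by (simp add: \<tau>'_def)
  have "frontier \<Omega> \<in> null_sets lborel"
    using negligible_convex_frontier[OF cvx] compact_frontier[OF cpt]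
    by (simp add: negligible_iff_null_sets null_sets_completion_iff borel_compact)
  then have fr0: "measure lborel (frontier \<Omega>) = 0" by (simp add: measure_eq_0_null_sets)
  obtain V d2 where V: "d2 > 0" "V \<in> fmeasurable lborel" "measure lborel V \<le> measure lborel (frontier \<Omega>) + \<tau>'"
    "\<And>x y. x \<in> frontier \<Omega> \<Longrightarrow> dist x y < d2 \<Longrightarrow> y \<in> V"
    using compact_measure_nbhd[OF compact_frontier[OF cpt] \<tau>'] by metis
  show ?thesis
  \<comment> \<open>The first bound keeps the cells of side a r / r0 within the d1-neighbourhood of
    \<Omega>, the second keeps the boundary layer within the d2-neighbourhood of the
    frontier.\<close>
  proof (rule that[of "min (d1 * r0 / (?d * a)) (d2 / 2)"])
    show "0 < min (d1 * r0 / (?d * a)) (d2 / 2)" using U(1) V(1) r0 a by simp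
    fix r assume r: "0 < r" and "r < min (d1 * r0 / (?d * a)) (d2 / 2)"
    then have r1: "?d * (r / r0 * a) < d1" and r2: "2 * r < d2"
      using r0 a by (auto simp: field_simps)
    have rr: "r / r0 * r0 = r" using r0 by simp
    have "\<exists>F. finite F \<and> (\<forall>x\<in>\<Omega>. \<exists>c\<in>F. dist x c \<le> r / r0 * r0) \<and>
      real (card F) * (\<nu> * (r / r0 * r0) ^ DIM('a)) \<le> D' * measure lborel U"
    proof (rule scaled_cube_cover[OF a P(1) _ P(3)])
      show "y \<in> U" if "x \<in> \<Omega>" "dist x y \<le> ?d * (r / r0 * a)" for x y
        using U(4)[OF that(1)] that(2) r1 by simp
    qed (use D \<nu> r0 r U(2) P(2) in auto)
    then obtain F where F: "finite F" "\<And>x. x \<in> \<Omega> \<Longrightarrow> \<exists>c\<in>F. dist x c \<le> r"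
      "real (card F) * (\<nu> * r ^ DIM('a)) \<le> D' * measure lborel U"
      unfolding rr by blast
    have "\<exists>N\<subseteq>\<Omega>. finite N \<and> (\<forall>x\<in>\<Omega>. (\<exists>z\<in>frontier \<Omega>. dist x z \<le> r) \<longrightarrow> (\<exists>c\<in>N. dist x c \<le> r / 2)) \<and>
      real (card N) * r ^ DIM('a) \<le> measure lborel V * (2 * ?d) ^ DIM('a)"
      by (rule frontier_layer_net[OF r V(2)]) (use V(4) r2 in auto)
    then obtain N where N: "N \<subseteq> \<Omega>" "finite N"
      "\<And>x. x \<in> \<Omega> \<Longrightarrow> \<exists>z\<in>frontier \<Omega>. dist x z \<le> r \<Longrightarrow> \<exists>c\<in>N. dist x c \<le> r / 2"
      "real (card N) * r ^ DIM('a) \<le> measure lborel V * (2 * ?d) ^ DIM('a)" by blast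
    have near: "\<exists>z\<in>(F \<inter> \<Omega>) \<union> N. dist x z \<le> r" if x: "x \<in> \<Omega>" for x
    proof -
      obtain c where c: "c \<in> F" "dist x c \<le> r" using F(2)[OF x] by blast
      show ?thesis
      proof (cases "c \<in> \<Omega>")
        case True
        then show ?thesis using c by blast
      next
        case False
        have "closed_segment x c \<inter> frontier \<Omega> \<noteq> {}"
          by (rule connected_Int_frontier) (use x False in auto)
        then obtain z where z: "z \<in> closed_segment x c" "z \<in> frontier \<Omega>" by blast
        have "dist x z \<le> r" using segment_bound(1)[OF z(1)] c(2) by (simp add: dist_norm norm_minus_commute)
        then obtain y where "y \<in> N" "dist x y \<le> r / 2" using N(3)[OF x] z(2) by blast
        then show ?thesis using r by (intro bexI[of _ y]) auto
      qed
    qed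
    have bd: "\<exists>z\<in>(F \<inter> \<Omega>) \<union> N. dist x z \<le> r / 2" if "x \<in> \<Omega> - interior \<Omega>" for x
    proof -
      have "x \<in> frontier \<Omega>" using that closure_subset by (auto simp: frontier_def)
      then have "\<exists>z\<in>frontier \<Omega>. dist x z \<le> r" using r by (intro bexI[of _ x]) auto
      then show ?thesis using N(3)[of x] that by blast
    qed
    have "real (card ((F \<inter> \<Omega>) \<union> N)) \<le> real (card F) + real (card N)"
      using card_Un_le[of "F \<inter> \<Omega>" N] card_mono[OF F(1), of "F \<inter> \<Omega>"] by simp
    then have "real (card ((F \<inter> \<Omega>) \<union> N)) * (\<nu> * r ^ DIM('a)) \<le> (real (card F) + real (card N)) * (\<nu> * r ^ DIM('a))"
      using \<nu> r by (intro mult_right_mono) auto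
    also have "\<dots> = real (card F) * (\<nu> * r ^ DIM('a)) + \<nu> * (real (card N) * r ^ DIM('a))"
      by (simp add: algebra_simps)
    also have "\<dots> \<le> D' * (measure lborel \<Omega> + \<tau>) + \<nu> * (\<tau>' * (2 * ?d) ^ DIM('a))"
    proof (rule add_mono)
      show "real (card F) * (\<nu> * r ^ DIM('a)) \<le> D' * (measure lborel \<Omega> + \<tau>)"
        using F(3) mult_left_mono[OF U(3), of D'] D by linarith
      have "measure lborel V * (2 * ?d) ^ DIM('a) \<le> \<tau>' * (2 * ?d) ^ DIM('a)"
        using V(3) fr0 by (intro mult_right_mono) auto
      then show "\<nu> * (real (card N) * r ^ DIM('a)) \<le> \<nu> * (\<tau>' * (2 * ?d) ^ DIM('a))"
        using order_trans[OF N(4)] \<nu> by (intro mult_left_mono) auto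
    qed
    also have "\<nu> * (\<tau>' * (2 * ?d) ^ DIM('a)) = \<tau>" using \<nu> by (simp add: \<tau>'_def)
    finally have crd: "real (card ((F \<inter> \<Omega>) \<union> N)) * (\<nu> * r ^ DIM('a)) \<le> D' * (measure lborel \<Omega> + \<tau>) + \<tau>" .
    show "\<exists>\<xi>\<subseteq>\<Omega>. finite \<xi> \<and> (\<forall>x\<in>\<Omega>. \<exists>z\<in>\<xi>. dist x z \<le> r) \<and>
      (\<forall>x\<in>\<Omega> - interior \<Omega>. \<exists>z\<in>\<xi>. dist x z \<le> r / 2) \<and>
      real (card \<xi>) * (measure lborel (ball (0::'a) 1) * r ^ DIM('a)) \<le> D' * (measure lborel \<Omega> + \<tau>) + \<tau>"
      using near bd crd N(1,2) F(1) unfolding \<nu>_def[symmetric] by (intro exI[of _ "(F \<inter> \<Omega>) \<union> N"]) auto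
  qed
qed

section \<open>The asymptotic bound\<close>

theorem theorem1:
  fixes \<Omega> :: "'a::euclidean_space set" and p q :: real
  assumes "convex_body \<Omega>"
  shows "limsup (\<lambda>n. ereal (real n powr (2 / real DIM('a))) * R_n p q \<Omega> n)
    \<le> ereal (1/4 * (enn2real (Theta TYPE('a)) * measure lborel \<Omega>
                     / measure lborel (ball (0::'a) 1)) powr (2 / real DIM('a)))"
proof -
  let ?d = "real DIM('a)"
  define \<theta> where "\<theta> = enn2real (Theta TYPE('a))"
  define \<mu> where "\<mu> = measure lborel \<Omega>"
  define \<nu> where "\<nu> = measure lborel (ball (0::'a) 1)"
  \<comment> \<open>The node count times r^d is at most \<open>A \<tau>\<close>, so r^d =
    \<open>A \<tau>\<close> / n is the smallest radius for which this count guarantees at most n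
    nodes. The summand 2 \<tau> leaves room for a density \<theta> + \<tau> strictly
    between.\<close>
  define A where "A \<tau> = ((\<theta> + 2 * \<tau>) * (\<mu> + \<tau>) + \<tau>) / \<nu>" for \<tau>
  define bound where "bound \<tau> = (1 + \<tau>) * (1/4 * A \<tau> powr (2 / ?d))" for \<tau>
  let ?S = "limsup (\<lambda>n. ereal (real n powr (2 / ?d)) * R_n p q \<Omega> n)"
  have \<nu>: "\<nu> > 0" by (simp add: \<nu>_def content_ball)
  have \<theta>0: "\<theta> \<ge> 0" and \<mu>0: "\<mu> \<ge> 0" by (auto simp: \<theta>_def \<mu>_def)
  have d: "?d > 0" by simp
  have Th: "Theta TYPE('a) = ennreal \<theta>"
    using Theta_finite[where 'a = 'a] by (simp add: \<theta>_def)
  have A_pos: "A \<tau> > 0" if "\<tau> > 0" for \<tau>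
    unfolding A_def using that \<theta>0 \<mu>0 \<nu> by (intro divide_pos_pos add_nonneg_pos) auto
  have main: "?S \<le> ereal (bound \<tau>)" if \<tau>: "\<tau> > 0" for \<tau>
  proof -
    define r where "r n = (A \<tau> / real n) powr (1 / ?d)" for n :: nat
    have "Theta TYPE('a) < ennreal (\<theta> + \<tau>)" unfolding Th using \<theta>0 \<tau> by (intro ennreal_lessI) auto
    then obtain \<rho> where \<rho>: "\<rho> > 0" "\<And>r. 0 < r \<Longrightarrow> r < \<rho> \<Longrightarrow> \<exists>\<xi>\<subseteq>\<Omega>. finite \<xi> \<and> (\<forall>x\<in>\<Omega>. \<exists>z\<in>\<xi>. dist x z \<le> r) \<and>
      (\<forall>x\<in>\<Omega> - interior \<Omega>. \<exists>z\<in>\<xi>. dist x z \<le> r / 2) \<and>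
      real (card \<xi>) * (\<nu> * r ^ DIM('a)) \<le> (\<theta> + 2 * \<tau>) * (\<mu> + \<tau>) + \<tau>"
      unfolding \<nu>_def \<mu>_def
      by (rule node_set_exists[OF assms, of "\<theta> + \<tau>" "\<theta> + 2 * \<tau>" \<tau>]) (use \<theta>0 \<tau> in auto)
    have r0: "r \<longlonglongrightarrow> 0" unfolding r_def
      by (rule tendsto_zero_powrI[OF lim_const_over_n tendsto_const])
        (use A_pos[OF \<tau>] in auto)
    have "(\<lambda>n. r n * (\<bar>p\<bar> + \<bar>q\<bar> * r n)) \<longlonglongrightarrow> 0 * (\<bar>p\<bar> + \<bar>q\<bar> * 0)"
      by (intro tendsto_intros r0)
    then have "(\<lambda>n. r n * (\<bar>p\<bar> + \<bar>q\<bar> * r n)) \<longlonglongrightarrow> 0" by simp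
    \<comment> \<open>Below 1/2 as \<open>rec_err_le\<close> demands, and below \<tau> / 2 so that
      its factor is at most 1 + \<tau>.\<close>
    then have "\<forall>\<^sub>F n in sequentially. r n * (\<bar>p\<bar> + \<bar>q\<bar> * r n) < min (1/2) (\<tau> / 2)"
      using \<tau> by (intro order_tendstoD(2)) auto
    moreover have "\<forall>\<^sub>F n in sequentially. r n < \<rho>" using r0 \<rho>(1) by (rule order_tendstoD(2))
    ultimately have "\<forall>\<^sub>F n in sequentially. ereal (real n powr (2 / ?d)) * R_n p q \<Omega> n \<le> ereal (bound \<tau>)"
      using eventually_gt_at_top[of 0]
    proof eventually_elim
      case (elim n)
      have n: "real n > 0" using elim(3) by simp
      have An: "A \<tau> / real n > 0" using A_pos[OF \<tau>] n by simp
      have rn: "r n > 0" unfolding r_def using A_pos[OF \<tau>] n by simp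
      have rd: "r n ^ DIM('a) = A \<tau> / real n"
        unfolding r_def using A_pos[OF \<tau>] n by (subst powr_power) auto
      have r2: "(r n)\<^sup>2 = (A \<tau> / real n) powr (2 / ?d)"
        unfolding r_def using A_pos[OF \<tau>] n by (subst powr_power) auto
      obtain \<xi> where \<xi>: "\<xi> \<subseteq> \<Omega>" "finite \<xi>" "\<And>x. x \<in> \<Omega> \<Longrightarrow> \<exists>z\<in>\<xi>. dist x z \<le> r n"
        "\<And>x. x \<in> \<Omega> - interior \<Omega> \<Longrightarrow> \<exists>z\<in>\<xi>. dist x z \<le> r n / 2"
        "real (card \<xi>) * (\<nu> * r n ^ DIM('a)) \<le> (\<theta> + 2 * \<tau>) * (\<mu> + \<tau>) + \<tau>"
        using \<rho>(2)[OF rn elim(2)] by blast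
      have "real (card \<xi>) * (\<nu> * (A \<tau> / real n)) \<le> \<nu> * A \<tau>"
        using \<xi>(5) \<nu> unfolding rd by (simp add: A_def)
      then have "(\<nu> * A \<tau>) * real (card \<xi>) \<le> (\<nu> * A \<tau>) * real n" using n by (simp add: field_simps)
      then have card: "card \<xi> \<le> n" using \<nu> A_pos[OF \<tau>] by simp
      have "R_n p q \<Omega> n \<le> rec_err p q \<Omega> \<xi>"
        unfolding R_n_def by (rule INF_lower) (use \<xi>(1,2) card in simp)
      also have "\<dots> \<le> ereal ((1 + 2 * (r n * (\<bar>p\<bar> + \<bar>q\<bar> * r n))) * (r n)\<^sup>2 / 4)"
        by (rule rec_err_le[OF assms \<xi>(1) rn _ \<xi>(3,4)]) (use elim(1) in auto)
      also have "\<dots> \<le> ereal ((1 + \<tau>) * (r n)\<^sup>2 / 4)"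
        unfolding ereal_less_eq using elim(1) by (intro divide_right_mono mult_right_mono) auto
      finally have "ereal (real n powr (2 / ?d)) * R_n p q \<Omega> n \<le> ereal (real n powr (2 / ?d)) * ereal ((1 + \<tau>) * (r n)\<^sup>2 / 4)"
        by (intro ereal_mult_left_mono) auto
      also have "\<dots> = ereal ((1 + \<tau>) * (1/4 * (real n powr (2 / ?d) * (A \<tau> / real n) powr (2 / ?d))))"
        unfolding r2 by simp
      also have "real n powr (2 / ?d) * (A \<tau> / real n) powr (2 / ?d) = A \<tau> powr (2 / ?d)"
        using n An by (subst powr_mult[symmetric]) auto
      finally show ?case by (simp add: bound_def)
    qed
    then show ?thesis by (rule Limsup_bounded)
  qed
  have "(bound \<longlongrightarrow> (1 + 0) * (1/4 * (((\<theta> + 2 * 0) * (\<mu> + 0) + 0) / \<nu>) powr (2 / ?d))) (at_right 0)"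
    unfolding bound_def[abs_def] A_def
  proof (intro tendsto_intros tendsto_powr')
    \<comment> \<open>The limit of the base has not been shown to be nonzero, so continuity of
      \<open>powr\<close> is used in its version for a nonnegative base and a positive
      exponent.\<close>
    show "((\<theta> + 2 * 0) * (\<mu> + 0) + 0) / \<nu> \<noteq> 0 \<or> 0 < 2 / ?d \<and>
      (\<forall>\<^sub>F \<tau> in at_right 0. 0 \<le> ((\<theta> + 2 * \<tau>) * (\<mu> + \<tau>) + \<tau>) / \<nu>)"
    proof (intro disjI2 conjI)
      show "\<forall>\<^sub>F \<tau> in at_right 0. 0 \<le> ((\<theta> + 2 * \<tau>) * (\<mu> + \<tau>) + \<tau>) / \<nu>"
        using eventually_at_right_less by (rule eventually_mono) (use A_pos in \<open>force simp: A_def\<close>)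
    qed simp
  qed (use \<nu> in auto)
  then have "((\<lambda>\<tau>. ereal (bound \<tau>)) \<longlongrightarrow> ereal (1/4 * (\<theta> * \<mu> / \<nu>) powr (2 / ?d))) (at_right 0)"
    by (simp add: tendsto_ereal)
  then have "?S \<le> ereal (1/4 * (\<theta> * \<mu> / \<nu>) powr (2 / ?d))"
  proof (rule tendsto_lowerbound)
    show "\<forall>\<^sub>F \<tau> in at_right 0. ?S \<le> ereal (bound \<tau>)"
      using eventually_at_right_less by (rule eventually_mono) (rule main)
  qed simp
  then show ?thesis by (simp add: \<theta>_def \<mu>_def \<nu>_def)
qed

end
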